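(* The optimal linear $\mathbf{D}$-policy is $f(x)=-Kx$.
   Context: The mispricing $x_t$ of an asset follows the Ornstein-Uhlenbeck process $dx_t=-\alpha x_t\,dt+\sigma\,dz_t$, where $z_t$ is a standard Wiener process, $\alpha>0$ and $\sigma>0$. An investment policy is a leverage function $f(x)$ of the mispricing; under the policy $f$ the logarithm of the investor's wealth $u_t$ evolves according to $du_t=f(x_t)\,dx_t$ (in the Itô sense). A $\mathbf{D}$-policy is a policy $f\in C^1(-\infty,+\infty)$ with $|f'(x)|\le K$ for all $x$, where $K$ is a fixed constant; a linear policy is one that is linear as a function of $x$. A policy is optimal in a class if it maximizes, over that class, the investor's utility $$U=\liminf_{t\to\infty}\frac1t\left[E(u_t)-\gamma\,\mathrm{Var}(u_t)\right],$$ where the parameter $\gamma$ measures risk aversion. *)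

theory Defs
  imports "HOL-Probability.Probability"
begin

text \<open>Time is indexed by \<^typ>\<open>real\<close>; only times \<open>t \<ge> 0\<close> are constrained or used.
  A filtration is a family of \<open>\<sigma>\<close>-algebras in the sense of the locale \<^locale>\<open>filtration\<close>,
  contained in the \<open>\<sigma>\<close>-algebra of the probability space.\<close>

definition filtered_prob_space :: "'a measure \<Rightarrow> (real \<Rightarrow> 'a measure) \<Rightarrow> bool" where
  "filtered_prob_space M F \<longleftrightarrow>
     prob_space M \<and> filtration (space M) F \<and> (\<forall>t. subalgebra M (F t))"

definition wiener_process ::
    "'a measure \<Rightarrow> (real \<Rightarrow> 'a measure) \<Rightarrow> (real \<Rightarrow> 'a \<Rightarrow> real) \<Rightarrow> bool" where
  "wiener_process M F z \<longleftrightarrow>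
     (\<forall>t\<ge>0. z t \<in> borel_measurable (F t)) \<and>
     (\<forall>\<omega>\<in>space M. continuous_on {0..} (\<lambda>t. z t \<omega>)) \<and>
     (AE \<omega> in M. z 0 \<omega> = 0) \<and>
     (\<forall>s t. 0 \<le> s \<and> s < t \<longrightarrow>
        distributed M lborel (\<lambda>\<omega>. z t \<omega> - z s \<omega>) (normal_density 0 (sqrt (t - s))) \<and>
        prob_space.indep_set M (sets (F s))
          {(\<lambda>\<omega>. z t \<omega> - z s \<omega>) -` B \<inter> space M | B. B \<in> sets borel})"

text \<open>\<open>dx = - \<alpha> x dt + \<sigma> dz\<close> in integral form; since \<open>\<sigma>\<close> is constant and \<open>z\<close> starts at \<open>0\<close>,
  the stochastic term \<open>\<integral>\<sigma> dz\<close> over \<open>[0, t]\<close> is \<open>\<sigma> z\<^sub>t\<close>. The initial value \<open>x 0\<close> is any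
  \<open>F 0\<close>-measurable random variable, hence independent of the Wiener process.\<close>

definition ornstein_uhlenbeck ::
    "'a measure \<Rightarrow> (real \<Rightarrow> 'a measure) \<Rightarrow> (real \<Rightarrow> 'a \<Rightarrow> real) \<Rightarrow> real \<Rightarrow> real
      \<Rightarrow> (real \<Rightarrow> 'a \<Rightarrow> real) \<Rightarrow> bool" where
  "ornstein_uhlenbeck M F z \<alpha> \<sigma> x \<longleftrightarrow>
     (\<forall>t\<ge>0. x t \<in> borel_measurable (F t)) \<and>
     (\<forall>\<omega>\<in>space M. continuous_on {0..} (\<lambda>t. x t \<omega>)) \<and>
     (AE \<omega> in M. \<forall>t\<ge>0. x t \<omega> = x 0 \<omega> + (LINT s:{0..t}|lborel. - \<alpha> * x s \<omega>) + \<sigma> * z t \<omega>)"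

text \<open>The triple \<open>n, \<tau>, \<xi>\<close> represents the elementary process
  \<open>\<Sum>i<n. \<xi>\<^sub>i 1\<^bsub>(\<tau>\<^sub>i, \<tau>\<^sub>i\<^sub>+\<^sub>1]\<^esub>\<close> on \<open>[0, T]\<close>, with \<open>\<xi>\<^sub>i\<close> square integrable and \<open>F (\<tau> i)\<close>-measurable.\<close>

definition elementary_process ::
    "'a measure \<Rightarrow> (real \<Rightarrow> 'a measure) \<Rightarrow> real \<Rightarrow> nat \<Rightarrow> (nat \<Rightarrow> real) \<Rightarrow> (nat \<Rightarrow> 'a \<Rightarrow> real)
      \<Rightarrow> bool" where
  "elementary_process M F T n \<tau> \<xi> \<longleftrightarrow>
     0 \<le> \<tau> 0 \<and> \<tau> n \<le> T \<and>
     (\<forall>i<n. \<tau> i \<le> \<tau> (Suc i) \<and> \<xi> i \<in> borel_measurable (F (\<tau> i)) \<and>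
        integrable M (\<lambda>\<omega>. (\<xi> i \<omega>)\<^sup>2))"

definition elementary_value ::
    "nat \<Rightarrow> (nat \<Rightarrow> real) \<Rightarrow> (nat \<Rightarrow> 'a \<Rightarrow> real) \<Rightarrow> real \<Rightarrow> 'a \<Rightarrow> real" where
  "elementary_value n \<tau> \<xi> s \<omega> = (\<Sum>i<n. \<xi> i \<omega> * indicator {\<tau> i<..\<tau> (Suc i)} s)"

definition elementary_integral ::
    "(real \<Rightarrow> 'a \<Rightarrow> real) \<Rightarrow> nat \<Rightarrow> (nat \<Rightarrow> real) \<Rightarrow> (nat \<Rightarrow> 'a \<Rightarrow> real) \<Rightarrow> 'a \<Rightarrow> real" where
  "elementary_integral z n \<tau> \<xi> \<omega> = (\<Sum>i<n. \<xi> i \<omega> * (z (\<tau> (Suc i)) \<omega> - z (\<tau> i) \<omega>))"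

text \<open>The \<open>L\<^sup>2\<close> Ito integral \<open>\<integral>H dz\<close> over \<open>[0, T]\<close>: the integrand \<open>H\<close> is jointly measurable and
  adapted, and \<open>I\<close> is the \<open>L\<^sup>2\<close>-limit of the integrals of elementary processes that converge to
  \<open>H\<close> in \<open>L\<^sup>2([0, T] \<times> M)\<close>. The integral is determined only up to null sets.\<close>

definition has_ito_integral ::
    "'a measure \<Rightarrow> (real \<Rightarrow> 'a measure) \<Rightarrow> (real \<Rightarrow> 'a \<Rightarrow> real) \<Rightarrow> real \<Rightarrow> (real \<Rightarrow> 'a \<Rightarrow> real)
      \<Rightarrow> ('a \<Rightarrow> real) \<Rightarrow> bool" where
  "has_ito_integral M F z T H I \<longleftrightarrow>
     (\<lambda>(s, \<omega>). H s \<omega>) \<in> borel_measurable (restrict_space lborel {0..T} \<Otimes>\<^sub>M M) \<and>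
     (\<forall>s\<in>{0..T}. H s \<in> borel_measurable (F s)) \<and>
     I \<in> borel_measurable M \<and>
     (\<exists>n \<tau> \<xi>.
        (\<forall>k. elementary_process M F T (n k) (\<tau> k) (\<xi> k)) \<and>
        (\<lambda>k. \<integral>\<^sup>+\<omega>. (\<integral>\<^sup>+s\<in>{0..T}.
            ennreal ((H s \<omega> - elementary_value (n k) (\<tau> k) (\<xi> k) s \<omega>)\<^sup>2) \<partial>lborel) \<partial>M)
          \<longlonglongrightarrow> 0 \<and>
        (\<lambda>k. \<integral>\<^sup>+\<omega>. ennreal ((I \<omega> - elementary_integral z (n k) (\<tau> k) (\<xi> k) \<omega>)\<^sup>2) \<partial>M)
          \<longlonglongrightarrow> 0)"

definition ito_integral ::
    "'a measure \<Rightarrow> (real \<Rightarrow> 'a measure) \<Rightarrow> (real \<Rightarrow> 'a \<Rightarrow> real) \<Rightarrow> real \<Rightarrow> (real \<Rightarrow> 'a \<Rightarrow> real)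
      \<Rightarrow> 'a \<Rightarrow> real" where
  "ito_integral M F z T H = (SOME I. has_ito_integral M F z T H I)"

text \<open>Log-wealth: \<open>du = f(x) dx = f(x) (- \<alpha> x dt + \<sigma> dz)\<close>, started from \<open>u\<^sub>0\<close>.\<close>

definition log_wealth ::
    "'a measure \<Rightarrow> (real \<Rightarrow> 'a measure) \<Rightarrow> (real \<Rightarrow> 'a \<Rightarrow> real) \<Rightarrow> real \<Rightarrow> real
      \<Rightarrow> (real \<Rightarrow> 'a \<Rightarrow> real) \<Rightarrow> real \<Rightarrow> (real \<Rightarrow> real) \<Rightarrow> real \<Rightarrow> 'a \<Rightarrow> real" where
  "log_wealth M F z \<alpha> \<sigma> x u\<^sub>0 f t \<omega> =
     u\<^sub>0 + (LINT s:{0..t}|lborel. f (x s \<omega>) * (- \<alpha> * x s \<omega>))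
        + ito_integral M F z t (\<lambda>s \<omega>. f (x s \<omega>) * \<sigma>) \<omega>"

definition investor_utility :: "'a measure \<Rightarrow> real \<Rightarrow> (real \<Rightarrow> 'a \<Rightarrow> real) \<Rightarrow> ereal" where
  "investor_utility M \<gamma> u =
     Liminf at_top (\<lambda>t. ereal (1 / t *
       (prob_space.expectation M (u t) - \<gamma> * prob_space.variance M (u t))))"

definition D_policies :: "real \<Rightarrow> (real \<Rightarrow> real) set" where
  "D_policies K = {f. f C1_differentiable_on UNIV \<and> (\<forall>x. \<bar>deriv f x\<bar> \<le> K)}"

definition linear_D_policies :: "real \<Rightarrow> (real \<Rightarrow> real) set" where
  "linear_D_policies K = {f \<in> D_policies K. linear f}"

definition optimal_policy ::
    "((real \<Rightarrow> real) \<Rightarrow> ereal) \<Rightarrow> (real \<Rightarrow> real) set \<Rightarrow> (real \<Rightarrow> real) \<Rightarrow> bool" where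
  "optimal_policy U C f \<longleftrightarrow> f \<in> C \<and> (\<forall>g\<in>C. U g \<le> U f)"

end

theory Submission
  imports Defs
begin

text \<open>For a linear policy \<open>f(y) = a y\<close> Ito's formula integrates the wealth equation in closed form,
  \<open>u\<^sub>t = u\<^sub>0 + a (x\<^sub>t\<^sup>2 - x\<^sub>0\<^sup>2 - \<sigma>\<^sup>2 t) / 2\<close> almost surely. The fourth moments of \<open>x\<^sub>t\<close> are bounded
  uniformly in \<open>t\<close>, hence \<open>E u\<^sub>t = - a \<sigma>\<^sup>2 t / 2 + O(1)\<close> and \<open>Var u\<^sub>t = O(1)\<close>. So the utility is
  \<open>- a \<sigma>\<^sup>2 / 2\<close> whatever the risk aversion, and over \<open>\<bar>a\<bar> \<le> K\<close> it is maximal exactly at \<open>a = - K\<close>.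
  The moment bound comes from
  \<open>x\<^sub>t = e\<^bsup>-\<alpha>t\<^esup> (x\<^sub>0 + \<sigma> z\<^sub>t) + \<integral>\<alpha> e\<^bsup>-\<alpha>(t-s)\<^esup> \<sigma> (z\<^sub>t - z\<^sub>s) ds\<close> and Jensen's inequality. Ito's formula
  for \<open>x\<^sup>2\<close> comes from left-endpoint sums over uniform partitions, with an \<open>L\<^sup>2\<close> error of the order
  of the square root of the mesh.\<close>

subsection \<open>Processes with continuous paths\<close>

text \<open>\<open>ito_integral\<close> is an arbitrary choice among the functions satisfying
  \<open>has_ito_integral\<close>. A closed form for one such function says nothing about wealth
  until uniqueness up to null sets is known. That is the role of the isometry: it compares two
  unrelated approximating sequences. Fourth moments are the natural currency because the variance of
  wealth involves the square of \<open>x t\<close>. Products are therefore split pointwise into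
  fourth powers. In Ito's formula two kinds of error meet over N steps of length h = T/N. Local
  errors of mean square O(h^3) may be summed crudely, since N^2 * h^3 = T^2 * h. Replacing h by the
  squared Wiener increment has mean square 2 * h^2 per step, and the crude sum N^2 * h^2 does not
  vanish. This part is separated and summed by orthogonality. The solution formula contains only
  differences of Wiener values under an ordinary integral. The moment bound thus needs no stochastic
  integral of the exponential kernel.\<close>

lemma borel_measurable_continuous_paths:
  fixes g :: "real \<Rightarrow> 'a \<Rightarrow> real"
  assumes "a \<le> b"
    and meas: "\<And>s. s \<in> {a..b} \<Longrightarrow> g s \<in> borel_measurable M"
    and cont: "\<And>\<omega>. \<omega> \<in> space M \<Longrightarrow> continuous_on {a..b} (\<lambda>s. g s \<omega>)"
  shows "(\<lambda>(s, \<omega>). g s \<omega>) \<in> borel_measurable (restrict_space lborel {a..b} \<Otimes>\<^sub>M M)"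
proof -
  define R where "R = restrict_space lborel {a..b}"
  \<comment> \<open>Time rounded down to a grid of mesh 1/(n+1). The clamp handles grid indices that
    leave the interval, since measurability of \<open>g s\<close> is assumed only for
    \<open>s\<close> in \<open>{a..b}\<close>.\<close>
  define r where "r n s = max a (min b (a + real_of_int \<lfloor>(s - a) * Suc n\<rfloor> / Suc n))" for n :: nat and s
  have r_in: "r n s \<in> {a..b}" for n s
    using \<open>a \<le> b\<close> by (auto simp: r_def)
  have r_lim: "(\<lambda>n. r n s) \<longlonglongrightarrow> s" if "s \<in> {a..b}" for s
  proof -
    have bd: "\<bar>r n s - s\<bar> \<le> 1 / Suc n" for n
    proof -
      have "real_of_int \<lfloor>(s - a) * Suc n\<rfloor> / Suc n \<le> s - a"
        using of_int_floor_le[of "(s - a) * Suc n"] by (simp add: divide_simps)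
      moreover have "s - a - 1 / Suc n \<le> real_of_int \<lfloor>(s - a) * Suc n\<rfloor> / Suc n"
      proof -
        have "(s - a) * Suc n \<le> real_of_int \<lfloor>(s - a) * Suc n\<rfloor> + 1"
          by (rule real_of_int_floor_add_one_ge)
        then have "s - a \<le> (real_of_int \<lfloor>(s - a) * Suc n\<rfloor> + 1) / Suc n"
          by (simp add: pos_le_divide_eq)
        then show ?thesis by (simp add: add_divide_distrib)
      qed
      ultimately show ?thesis
        using that by (auto simp: r_def)
    qed
    have "(\<lambda>n. 1 / real (Suc n)) \<longlonglongrightarrow> 0"
      using LIMSEQ_Suc[OF lim_1_over_n] by simp
    then have "(\<lambda>n. r n s - s) \<longlonglongrightarrow> 0"
      by (rule Lim_null_comparison[rotated]) (use bd in auto)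
    then show ?thesis
      by (simp add: LIM_zero_iff)
  qed
  have *: "(\<lambda>p. g (r n (fst p)) (snd p)) \<in> borel_measurable (R \<Otimes>\<^sub>M M)" for n
  proof -
    have "(\<lambda>p. (\<lambda>i p. g (max a (min b (a + real_of_int i / Suc n))) (snd p)) \<lfloor>(fst p - a) * Suc n\<rfloor> p)
        \<in> borel_measurable (R \<Otimes>\<^sub>M M)"
    \<comment> \<open>The rounded time takes countably many values, so joint measurability reduces
      to that of \<open>g\<close> at single grid times.\<close>
    proof (rule measurable_compose_countable[where g = "\<lambda>p. \<lfloor>(fst p - a) * real (Suc n)\<rfloor>"])
      fix i :: int
      have [measurable]: "g (max a (min b (a + real_of_int i / Suc n))) \<in> borel_measurable M"
        using \<open>a \<le> b\<close> by (intro meas) auto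
      show "(\<lambda>p. g (max a (min b (a + real_of_int i / Suc n))) (snd p)) \<in> borel_measurable (R \<Otimes>\<^sub>M M)"
        by measurable
    next
      have [measurable]: "fst \<in> borel_measurable (R \<Otimes>\<^sub>M M)"
      proof -
        have "(\<lambda>s. s) \<in> borel_measurable R"
          unfolding R_def by (rule measurable_restrict_space1) simp
        then show ?thesis
          by (rule measurable_compose[OF measurable_fst])
      qed
      show "(\<lambda>p. \<lfloor>(fst p - a) * real (Suc n)\<rfloor>) \<in> measurable (R \<Otimes>\<^sub>M M) (count_space UNIV)"
        by measurable
    qed
    then show ?thesis
      by (simp add: r_def)
  qed
  have "(\<lambda>p. g (fst p) (snd p)) \<in> borel_measurable (R \<Otimes>\<^sub>M M)"
  proof (rule borel_measurable_LIMSEQ_real)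
    fix p assume "p \<in> space (R \<Otimes>\<^sub>M M)"
    then have p: "fst p \<in> {a..b}" "snd p \<in> space M"
      by (auto simp: space_pair_measure R_def space_restrict_space)
    show "(\<lambda>n. g (r n (fst p)) (snd p)) \<longlonglongrightarrow> g (fst p) (snd p)"
      using continuous_on_tendsto_compose[OF cont[OF p(2)] r_lim[OF p(1)] p(1)] r_in by auto
  qed (rule *)
  then show ?thesis
    by (simp add: R_def split_beta')
qed

lemma finite_measure_restrict_space_Icc: "finite_measure (restrict_space lborel {a..b :: real})"
  by (rule finite_measureI) (simp add: emeasure_restrict_space space_restrict_space emeasure_lborel_Icc_eq)

lemma set_lebesgue_integral_restrict_space:
  fixes f :: "real \<Rightarrow> real"
  shows "(LINT s:{a..b}|lborel. f s) = (\<integral>s. f s \<partial>restrict_space lborel {a..b})"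
  by (simp add: set_lebesgue_integral_def integral_restrict_space)

lemma integrable_restrict_space_continuous:
  fixes f :: "real \<Rightarrow> real"
  assumes "continuous_on {a..b} f"
  shows "integrable (restrict_space lborel {a..b}) f"
  using borel_integrable_atLeastAtMost'[OF assms]
  by (simp add: set_integrable_def integrable_restrict_space)

lemma borel_measurable_path_integral:
  fixes g :: "real \<Rightarrow> 'a \<Rightarrow> real"
  assumes "a \<le> b"
    and "\<And>s. s \<in> {a..b} \<Longrightarrow> g s \<in> borel_measurable M"
    and "\<And>\<omega>. \<omega> \<in> space M \<Longrightarrow> continuous_on {a..b} (\<lambda>s. g s \<omega>)"
  shows "(\<lambda>\<omega>. LINT s:{a..b}|lborel. g s \<omega>) \<in> borel_measurable M"
proof -
  interpret R: finite_measure "restrict_space lborel {a..b}"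
    by (rule finite_measure_restrict_space_Icc)
  have "(\<lambda>(\<omega>, s). g s \<omega>) \<in> borel_measurable (M \<Otimes>\<^sub>M restrict_space lborel {a..b})"
    using measurable_pair_swap[OF borel_measurable_continuous_paths[OF assms]] by simp
  then show ?thesis
    unfolding set_lebesgue_integral_restrict_space by (rule R.borel_measurable_lebesgue_integral)
qed

section \<open>Bounds on expectations\<close>

text \<open>Integrability is bundled with the bound because the Bochner integral of a non-integrable
  function is 0 and would satisfy any nonnegative bound.\<close>

definition mean_le :: "'a measure \<Rightarrow> ('a \<Rightarrow> real) \<Rightarrow> real \<Rightarrow> bool" where
  "mean_le M X B \<longleftrightarrow> integrable M X \<and> integral\<^sup>L M X \<le> B"

lemma mean_le_add: "mean_le M X A \<Longrightarrow> mean_le M Y B \<Longrightarrow> mean_le M (\<lambda>\<omega>. X \<omega> + Y \<omega>) (A + B)"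
  by (simp add: mean_le_def)

lemma mean_le_cmult: "mean_le M X A \<Longrightarrow> 0 \<le> c \<Longrightarrow> mean_le M (\<lambda>\<omega>. c * X \<omega>) (c * A)"
  by (simp add: mean_le_def mult_left_mono)

lemma mean_le_sum:
  "(\<And>i. i \<in> S \<Longrightarrow> mean_le M (X i) (B i)) \<Longrightarrow> mean_le M (\<lambda>\<omega>. \<Sum>i\<in>S. X i \<omega>) (\<Sum>i\<in>S. B i)"
  by (simp add: mean_le_def sum_mono)

lemma mean_le_trans: "mean_le M X A \<Longrightarrow> A \<le> B \<Longrightarrow> mean_le M X B"
  by (simp add: mean_le_def)

lemma mean_le_mono:
  assumes "mean_le M Y B" "X \<in> borel_measurable M" "AE \<omega> in M. 0 \<le> X \<omega> \<and> X \<omega> \<le> Y \<omega>"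
  shows "mean_le M X B"
proof -
  have "integrable M X"
    by (rule Bochner_Integration.integrable_bound[of M Y]) (use assms in \<open>auto simp: mean_le_def\<close>)
  moreover from this have "integral\<^sup>L M X \<le> integral\<^sup>L M Y"
    by (rule integral_mono_AE) (use assms in \<open>auto simp: mean_le_def\<close>)
  ultimately show ?thesis
    using assms by (simp add: mean_le_def)
qed

lemma mean_le_nn_integral:
  assumes "mean_le M X B" "AE \<omega> in M. 0 \<le> X \<omega>"
  shows "(\<integral>\<^sup>+\<omega>. ennreal (X \<omega>) \<partial>M) \<le> ennreal B"
  using assms by (subst nn_integral_eq_integral) (auto simp: mean_le_def ennreal_leI)

text \<open>Tonelli for nonnegative integrands. The exchange is done with extended nonnegative
  integrals; the finite bound obtained there is what yields integrability of the path
  integral.\<close>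

lemma mean_le_path_integral:
  fixes g :: "real \<Rightarrow> 'a \<Rightarrow> real"
  assumes "a \<le> b" "sigma_finite_measure M"
    and cont: "\<And>\<omega>. \<omega> \<in> space M \<Longrightarrow> continuous_on {a..b} (\<lambda>s. g s \<omega>)"
    and nn: "\<And>s \<omega>. s \<in> {a..b} \<Longrightarrow> \<omega> \<in> space M \<Longrightarrow> 0 \<le> g s \<omega>"
    and le: "\<And>s. s \<in> {a..b} \<Longrightarrow> mean_le M (g s) (B s)"
    and contB: "continuous_on {a..b} B"
  shows "mean_le M (\<lambda>\<omega>. LINT s:{a..b}|lborel. g s \<omega>) (LINT s:{a..b}|lborel. B s)"
proof -
  define R where "R = restrict_space lborel {a..b}"
  have spR: "space R = {a..b}"
    by (simp add: R_def space_restrict_space)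
  interpret R: finite_measure R
    unfolding R_def by (rule finite_measure_restrict_space_Icc)
  interpret M: sigma_finite_measure M by fact
  interpret pair_sigma_finite R M ..
  have meas: "s \<in> {a..b} \<Longrightarrow> g s \<in> borel_measurable M" for s
    using le by (auto simp: mean_le_def)
  have joint: "(\<lambda>(s, \<omega>). ennreal (g s \<omega>)) \<in> borel_measurable (R \<Otimes>\<^sub>M M)"
    using measurable_compose[OF borel_measurable_continuous_paths[OF \<open>a \<le> b\<close> meas cont] measurable_ennreal]
    by (simp add: split_beta' R_def)
  have meas_int: "(\<lambda>\<omega>. \<integral>s. g s \<omega> \<partial>R) \<in> borel_measurable M"
    using borel_measurable_path_integral[OF \<open>a \<le> b\<close> meas cont]
    by (simp add: set_lebesgue_integral_restrict_space R_def)
  have B0: "0 \<le> B s" if "s \<in> {a..b}" for s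
  proof -
    have "0 \<le> integral\<^sup>L M (g s)"
      by (rule integral_nonneg_AE) (use nn that in auto)
    also have "\<dots> \<le> B s" using le[OF that] by (simp add: mean_le_def)
    finally show ?thesis .
  qed
  have int0: "\<omega> \<in> space M \<Longrightarrow> 0 \<le> (\<integral>s. g s \<omega> \<partial>R)" for \<omega>
    by (rule integral_nonneg_AE) (use nn in \<open>auto simp: spR\<close>)
  have "(\<integral>\<^sup>+\<omega>. ennreal (\<integral>s. g s \<omega> \<partial>R) \<partial>M) = (\<integral>\<^sup>+\<omega>. (\<integral>\<^sup>+s. ennreal (g s \<omega>) \<partial>R) \<partial>M)"
    by (intro nn_integral_cong nn_integral_eq_integral[symmetric])
      (use nn in \<open>auto simp: spR R_def intro!: integrable_restrict_space_continuous cont\<close>)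
  also have "\<dots> = (\<integral>\<^sup>+s. (\<integral>\<^sup>+\<omega>. ennreal (g s \<omega>) \<partial>M) \<partial>R)"
    by (rule Fubini') (rule joint)
  also have "\<dots> \<le> (\<integral>\<^sup>+s. ennreal (B s) \<partial>R)"
    by (intro nn_integral_mono mean_le_nn_integral le) (use nn in \<open>auto simp: spR\<close>)
  also have "\<dots> = ennreal (\<integral>s. B s \<partial>R)"
    by (intro nn_integral_eq_integral)
      (use B0 in \<open>auto simp: spR R_def intro!: integrable_restrict_space_continuous contB\<close>)
  finally have le: "(\<integral>\<^sup>+\<omega>. ennreal (\<integral>s. g s \<omega> \<partial>R) \<partial>M) \<le> ennreal (\<integral>s. B s \<partial>R)" .
  have BR: "0 \<le> (\<integral>s. B s \<partial>R)"
    by (rule integral_nonneg_AE) (use B0 in \<open>auto simp: spR\<close>)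
  have int: "integrable M (\<lambda>\<omega>. \<integral>s. g s \<omega> \<partial>R)"
    by (rule integrableI_nonneg) (use int0 meas_int le in \<open>auto simp: top.not_eq_extremum[symmetric] top_unique\<close>)
  moreover have "integral\<^sup>L M (\<lambda>\<omega>. \<integral>s. g s \<omega> \<partial>R) \<le> (\<integral>s. B s \<partial>R)"
    using le int0 BR by (subst (asm) nn_integral_eq_integral[OF int]) (auto)
  ultimately show ?thesis
    by (simp add: mean_le_def set_lebesgue_integral_restrict_space R_def)
qed

text \<open>Integrating \<open>k * (g - c)\<^sup>2 \<ge> 0\<close> with \<open>c = \<integral>k g\<close> gives Jensen's inequality also for
  weights of total mass less than one.\<close>

lemma path_integral_power2_le:
  fixes k g :: "real \<Rightarrow> real"
  assumes k: "continuous_on {a..b} k" and g: "continuous_on {a..b} g"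
    and k0: "\<And>s. s \<in> {a..b} \<Longrightarrow> 0 \<le> k s" and k1: "(LINT s:{a..b}|lborel. k s) \<le> 1"
  shows "(LINT s:{a..b}|lborel. k s * g s)\<^sup>2 \<le> (LINT s:{a..b}|lborel. k s * (g s)\<^sup>2)"
proof -
  define c where "c = (LINT s:{a..b}|lborel. k s * g s)"
  have i1: "set_integrable lborel {a..b} k" "set_integrable lborel {a..b} (\<lambda>s. k s * g s)"
     "set_integrable lborel {a..b} (\<lambda>s. k s * (g s)\<^sup>2)"
    by (intro borel_integrable_atLeastAtMost' continuous_intros k g)+
  have "0 \<le> (LINT s:{a..b}|lborel. k s * (g s - c)\<^sup>2)"
    unfolding set_lebesgue_integral_def
    by (rule integral_nonneg_AE) (use k0 in \<open>auto simp: indicator_def\<close>)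
  also have "\<dots> = (LINT s:{a..b}|lborel. k s * (g s)\<^sup>2 - (2 * c) * (k s * g s) + c\<^sup>2 * k s)"
    by (rule set_lebesgue_integral_cong) (auto simp: power2_eq_square algebra_simps)
  also have "\<dots> = (LINT s:{a..b}|lborel. k s * (g s)\<^sup>2) - 2 * c * c + c\<^sup>2 * (LINT s:{a..b}|lborel. k s)"
    using i1 by (simp add: set_integral_add set_integral_diff c_def)
  also have "\<dots> \<le> (LINT s:{a..b}|lborel. k s * (g s)\<^sup>2) - 2 * c * c + c\<^sup>2 * 1"
    by (intro add_left_mono mult_left_mono k1) auto
  finally show ?thesis
    by (simp add: c_def power2_eq_square)
qed

text \<open>The square version is used twice with the same weight, first for \<open>g\<close> and
  then for its square.\<close>

lemma path_integral_power4_le: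
  fixes k g :: "real \<Rightarrow> real"
  assumes k: "continuous_on {a..b} k" and g: "continuous_on {a..b} g"
    and k0: "\<And>s. s \<in> {a..b} \<Longrightarrow> 0 \<le> k s" and k1: "(LINT s:{a..b}|lborel. k s) \<le> 1"
  shows "(LINT s:{a..b}|lborel. k s * g s) ^ 4 \<le> (LINT s:{a..b}|lborel. k s * g s ^ 4)"
proof -
  have "(LINT s:{a..b}|lborel. k s * g s) ^ 4 = ((LINT s:{a..b}|lborel. k s * g s)\<^sup>2)\<^sup>2"
    by simp
  also have "\<dots> \<le> (LINT s:{a..b}|lborel. k s * (g s)\<^sup>2)\<^sup>2"
    by (intro power_mono path_integral_power2_le assms) auto
  also have "\<dots> \<le> (LINT s:{a..b}|lborel. k s * ((g s)\<^sup>2)\<^sup>2)"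
    by (intro path_integral_power2_le continuous_intros assms)
  finally show ?thesis by simp
qed

lemma LINT_const: "a \<le> b \<Longrightarrow> (LINT s:{a..b}|lborel. (c::real)) = (b - a) * c"
  by (simp add: set_lebesgue_integral_def)


lemma LINT_singleton: "(LINT s:{a}|lborel. g s) = (0::real)" for a :: real
proof -
  have "(LINT s:{a..a}|lborel. g s) = (LINT s:{a..a}|lborel. g a)"
    by (rule set_lebesgue_integral_cong) auto
  also have "\<dots> = 0"
    using LINT_const[of a a "g a"] by (simp only: diff_self mult_zero_left)
  finally show ?thesis by simp
qed

text \<open>Jensen's inequality with the uniform weight \<open>1 / (b - a)\<close> applied to
  \<open>(b - a) * g\<close>. The one-point interval is separate because this weight degenerates
  there.\<close>

lemma integral_power2_le:
  fixes g :: "real \<Rightarrow> real"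
  assumes "a \<le> b" and g: "continuous_on {a..b} g"
  shows "(LINT s:{a..b}|lborel. g s)\<^sup>2 \<le> (b - a) * (LINT s:{a..b}|lborel. (g s)\<^sup>2)"
proof (cases "a = b")
  case False
  then have "a < b" using assms by simp
  then have "(LINT s:{a..b}|lborel. 1 / (b - a) * ((b - a) * g s))\<^sup>2
      \<le> (LINT s:{a..b}|lborel. 1 / (b - a) * ((b - a) * g s)\<^sup>2)"
    by (intro path_integral_power2_le continuous_intros g) (auto simp: LINT_const)
  also have "\<dots> = (LINT s:{a..b}|lborel. (b - a) * (g s)\<^sup>2)"
    using \<open>a < b\<close> by (intro set_lebesgue_integral_cong) (auto simp: power2_eq_square)
  finally show ?thesis using \<open>a < b\<close> by simp
next
  case True
  then show ?thesis by (simp add: LINT_singleton)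
qed

lemma integral_power4_le:
  fixes g :: "real \<Rightarrow> real"
  assumes "a \<le> b" and g: "continuous_on {a..b} g"
  shows "(LINT s:{a..b}|lborel. g s) ^ 4 \<le> (b - a) ^ 3 * (LINT s:{a..b}|lborel. g s ^ 4)"
proof -
  have "(LINT s:{a..b}|lborel. g s) ^ 4 = ((LINT s:{a..b}|lborel. g s)\<^sup>2)\<^sup>2"
    by simp
  also have "\<dots> \<le> ((b - a) * (LINT s:{a..b}|lborel. (g s)\<^sup>2))\<^sup>2"
    by (intro power_mono integral_power2_le assms) auto
  also have "\<dots> \<le> (b - a)\<^sup>2 * ((b - a) * (LINT s:{a..b}|lborel. ((g s)\<^sup>2)\<^sup>2))"
    unfolding power_mult_distrib
    by (intro mult_left_mono integral_power2_le continuous_intros assms) auto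
  finally show ?thesis by (simp add: power2_eq_square[of "b - a"] power3_eq_cube mult.assoc)
qed

subsection \<open>Ito integrals\<close>

lemma integrable_mult_power2:
  fixes X Y :: "'a \<Rightarrow> real"
  assumes "X \<in> borel_measurable M" "Y \<in> borel_measurable M"
    and "integrable M (\<lambda>\<omega>. (X \<omega>)\<^sup>2)" "integrable M (\<lambda>\<omega>. (Y \<omega>)\<^sup>2)"
  shows "integrable M (\<lambda>\<omega>. X \<omega> * Y \<omega>)"
proof (rule Bochner_Integration.integrable_bound)
  show "integrable M (\<lambda>\<omega>. (X \<omega>)\<^sup>2 + (Y \<omega>)\<^sup>2)"
    using assms by simp
  have "\<bar>x * y\<bar> \<le> x\<^sup>2 + y\<^sup>2" for x y :: real
    using sum_squares_bound[of "\<bar>x\<bar>" "\<bar>y\<bar>"] mult_nonneg_nonneg[of "\<bar>x\<bar>" "\<bar>y\<bar>"]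
    unfolding abs_mult power2_abs by linarith
  then show "AE \<omega> in M. norm (X \<omega> * Y \<omega>) \<le> norm ((X \<omega>)\<^sup>2 + (Y \<omega>)\<^sup>2)"
    by simp
qed (use assms in measurable)

section \<open>Moments and independence of Wiener increments\<close>

locale wiener = prob_space M
  for M :: "'a measure" +
  fixes F :: "real \<Rightarrow> 'a measure" and z :: "real \<Rightarrow> 'a \<Rightarrow> real"
  assumes filtered: "filtered_prob_space M F"
    and wiener: "wiener_process M F z"
begin

lemma space_F: "space (F t) = space M"
  using filtered by (simp add: filtered_prob_space_def subalgebra_def)

lemma measurable_F: "f \<in> borel_measurable (F t) \<Longrightarrow> f \<in> borel_measurable M"
  using filtered by (auto simp: filtered_prob_space_def intro: measurable_from_subalg)

lemma measurable_F_mono: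
  assumes "f \<in> borel_measurable (F s)" "s \<le> t"
  shows "f \<in> borel_measurable (F t)"
proof -
  have "sets (F s) \<subseteq> sets (F t)"
    using filtered \<open>s \<le> t\<close> filtration.sets_F_mono by (fastforce simp: filtered_prob_space_def)
  then show ?thesis
    using assms(1) by (auto simp: measurable_def space_F)
qed

lemma z_measurable_F: "0 \<le> t \<Longrightarrow> z t \<in> borel_measurable (F t)"
  using wiener by (simp add: wiener_process_def)

lemma z_measurable: "0 \<le> t \<Longrightarrow> z t \<in> borel_measurable M"
  by (rule measurable_F[OF z_measurable_F])

lemma increment_measurable_F:
  assumes "0 \<le> s" "s \<le> t" "t \<le> r"
  shows "(\<lambda>\<omega>. z t \<omega> - z s \<omega>) \<in> borel_measurable (F r)"
  using assms measurable_F_mono[OF z_measurable_F, of t r] measurable_F_mono[OF z_measurable_F, of s r]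
  by (intro borel_measurable_diff) auto

lemma increment_distributed:
  "0 \<le> s \<Longrightarrow> s < t \<Longrightarrow>
    distributed M lborel (\<lambda>\<omega>. z t \<omega> - z s \<omega>) (normal_density 0 (sqrt (t - s)))"
  using wiener by (simp add: wiener_process_def)

text \<open>Moments of the normal law. The definition prescribes the law only for
  \<open>s < t\<close>; the case \<open>s = t\<close> is checked directly so that later lemmas allow
  empty intervals.\<close>

lemma increment_moments:
  assumes "0 \<le> s" "s \<le> t"
  shows "integrable M (\<lambda>\<omega>. (z t \<omega> - z s \<omega>) ^ k)"
    and "expectation (\<lambda>\<omega>. z t \<omega> - z s \<omega>) = 0"
    and "expectation (\<lambda>\<omega>. (z t \<omega> - z s \<omega>)\<^sup>2) = t - s"
    and "expectation (\<lambda>\<omega>. (z t \<omega> - z s \<omega>) ^ 4) = 3 * (t - s)\<^sup>2"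
proof -
  have "integrable M (\<lambda>\<omega>. (z t \<omega> - z s \<omega>) ^ k) \<and> expectation (\<lambda>\<omega>. z t \<omega> - z s \<omega>) = 0 \<and>
    expectation (\<lambda>\<omega>. (z t \<omega> - z s \<omega>)\<^sup>2) = t - s \<and>
    expectation (\<lambda>\<omega>. (z t \<omega> - z s \<omega>) ^ 4) = 3 * (t - s)\<^sup>2"
  proof (cases "s = t")
    case True
    then show ?thesis by (cases k) auto
  next
    case False
    then have st: "s < t" "0 < sqrt (t - s)" using assms by auto
    note d = increment_distributed[OF assms(1) st(1)]
    note mom = distributed_integral[OF d, of "\<lambda>x. x ^ i" for i, simplified]
    have "integrable M (\<lambda>\<omega>. (z t \<omega> - z s \<omega>) ^ k)"
      using distributed_integrable[OF d, of "\<lambda>x. x ^ k"] integrable_normal_moment[OF st(2), of 0 k]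
      by simp
    moreover have "expectation (\<lambda>\<omega>. z t \<omega> - z s \<omega>) = 0"
      using mom[of 1] integral_normal_moment_odd[OF st(2), of 0 0] by simp
    moreover have "expectation (\<lambda>\<omega>. (z t \<omega> - z s \<omega>)\<^sup>2) = t - s"
      using mom[of 2] integral_normal_moment_even[OF st(2), of 0 1] st by simp
    moreover have "expectation (\<lambda>\<omega>. (z t \<omega> - z s \<omega>) ^ 4) = 3 * (t - s)\<^sup>2"
      using mom[of 4] integral_normal_moment_even[OF st(2), of 0 2] st
      by (simp add: fact_numeral power_divide)
    ultimately show ?thesis by simp
  qed
  then show "integrable M (\<lambda>\<omega>. (z t \<omega> - z s \<omega>) ^ k)"
    and "expectation (\<lambda>\<omega>. z t \<omega> - z s \<omega>) = 0"
    and "expectation (\<lambda>\<omega>. (z t \<omega> - z s \<omega>)\<^sup>2) = t - s"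
    and "expectation (\<lambda>\<omega>. (z t \<omega> - z s \<omega>) ^ 4) = 3 * (t - s)\<^sup>2"
    by auto
qed

text \<open>The preimages under \<open>X\<close> lie in \<open>F s\<close>, so \<open>X\<close>
  inherits from \<open>F s\<close> the independence from the increment, and expectations of products
  factor.\<close>

lemma increment_indep:
  fixes X :: "'a \<Rightarrow> real" and g :: "real \<Rightarrow> real"
  assumes st: "0 \<le> s" "s \<le> t" and X: "X \<in> borel_measurable (F s)" "integrable M X"
    and g: "g \<in> borel_measurable borel" "integrable M (\<lambda>\<omega>. g (z t \<omega> - z s \<omega>))"
  shows "integrable M (\<lambda>\<omega>. X \<omega> * g (z t \<omega> - z s \<omega>))"
    and "expectation (\<lambda>\<omega>. X \<omega> * g (z t \<omega> - z s \<omega>)) =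
      expectation X * expectation (\<lambda>\<omega>. g (z t \<omega> - z s \<omega>))"
proof -
  have "integrable M (\<lambda>\<omega>. X \<omega> * g (z t \<omega> - z s \<omega>)) \<and>
    expectation (\<lambda>\<omega>. X \<omega> * g (z t \<omega> - z s \<omega>)) =
      expectation X * expectation (\<lambda>\<omega>. g (z t \<omega> - z s \<omega>))"
  proof (cases "s = t")
    case True
    then show ?thesis using X by (simp add: prob_space)
  next
    case False
    let ?D = "\<lambda>\<omega>. z t \<omega> - z s \<omega>"
    let ?A = "{X -` A \<inter> space M | A. A \<in> sets borel}"
    let ?B = "{?D -` B \<inter> space M | B. B \<in> sets borel}"
    have D: "?D \<in> borel_measurable M"
      using st z_measurable by auto
    have ind: "indep_set (sets (F s)) ?B"
      using wiener st False by (simp add: wiener_process_def)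
    have sub: "?A \<subseteq> sets (F s)"
      using X(1) by (auto simp: measurable_def space_F)
    \<comment> \<open>Independence of random variables concerns the generated sigma-algebras;
      closure of the preimage families under intersection is what extends independence to
      them.\<close>
    have Int: "Int_stable {Y -` A \<inter> space M | A. A \<in> sets (borel :: real measure)}" for Y :: "'a \<Rightarrow> real"
    proof (rule Int_stableI, clarify)
      fix A B :: "real set" assume "A \<in> sets borel" "B \<in> sets borel"
      then show "\<exists>C. Y -` A \<inter> space M \<inter> (Y -` B \<inter> space M) = Y -` C \<inter> space M \<and> C \<in> sets borel"
        by (intro exI[of _ "A \<inter> B"]) auto
    qed
    have "indep_set ?A ?B"
      using ind sub unfolding indep_sets2_eq by blast
    then have "indep_var borel X borel ?D"
      unfolding indep_var_eq
      by (intro conjI indep_set_sigma_sets Int) (use measurable_F[OF X(1)] D in auto)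
    then have "indep_var borel (id \<circ> X) borel (g \<circ> ?D)"
      by (rule indep_var_compose) (use g in auto)
    then have iv: "indep_var borel X borel (\<lambda>\<omega>. g (?D \<omega>))"
      by (simp add: comp_def)
    show ?thesis
      using indep_var_integrable[OF iv X(2) g(2)] indep_var_lebesgue_integral[OF iv X(2) g(2)] by simp
  qed
  then show "integrable M (\<lambda>\<omega>. X \<omega> * g (z t \<omega> - z s \<omega>))"
    and "expectation (\<lambda>\<omega>. X \<omega> * g (z t \<omega> - z s \<omega>)) =
      expectation X * expectation (\<lambda>\<omega>. g (z t \<omega> - z s \<omega>))" by auto
qed

lemma increment_orthogonal:
  assumes "0 \<le> s" "s \<le> t" "X \<in> borel_measurable (F s)" "integrable M X"
  shows "integrable M (\<lambda>\<omega>. X \<omega> * (z t \<omega> - z s \<omega>))"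
    and "expectation (\<lambda>\<omega>. X \<omega> * (z t \<omega> - z s \<omega>)) = 0"
  using increment_indep[OF assms, of "\<lambda>x. x"] increment_moments[OF assms(1,2)]
    increment_moments(1)[OF assms(1,2), of 1] by auto

text \<open>Independence is applied to the two squares, so no moment of \<open>X\<close> beyond the
  second is required.\<close>

lemma increment_mult_power2:
  assumes "0 \<le> s" "s \<le> t" "X \<in> borel_measurable (F s)" "integrable M (\<lambda>\<omega>. (X \<omega>)\<^sup>2)"
  shows "integrable M (\<lambda>\<omega>. (X \<omega> * (z t \<omega> - z s \<omega>))\<^sup>2)"
proof -
  have [measurable]: "X \<in> borel_measurable (F s)" by fact
  have "integrable M (\<lambda>\<omega>. (X \<omega>)\<^sup>2 * (z t \<omega> - z s \<omega>)\<^sup>2)"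
    by (rule increment_indep[of s t "\<lambda>\<omega>. (X \<omega>)\<^sup>2" "\<lambda>x. x\<^sup>2"])
      (use assms increment_moments(1) in auto)
  then show ?thesis by (simp add: power_mult_distrib)
qed

section \<open>The Ito isometry\<close>

text \<open>Only the overlap of the two intervals contributes: every other piece of the product
  contains an increment whose cofactor is known at its left end, so its expectation is 0.\<close>

lemma isometry_pair_ordered:
  assumes ord: "0 \<le> a" "a \<le> b" "a \<le> a'" "a' \<le> b'"
    and X: "X \<in> borel_measurable (F a)" "integrable M (\<lambda>\<omega>. (X \<omega>)\<^sup>2)"
    and Y: "Y \<in> borel_measurable (F a')" "integrable M (\<lambda>\<omega>. (Y \<omega>)\<^sup>2)"
  shows "expectation (\<lambda>\<omega>. X \<omega> * (z b \<omega> - z a \<omega>) * (Y \<omega> * (z b' \<omega> - z a' \<omega>))) =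
    expectation (\<lambda>\<omega>. X \<omega> * Y \<omega>) * max 0 (min b b' - max a a')"
proof -
  have X': "X \<in> borel_measurable (F a')" by (rule measurable_F_mono[OF X(1) ord(3)])
  note meas = measurable_F[OF X(1)] measurable_F[OF Y(1)]
  note [measurable] = X' Y(1)
  \<comment> \<open>With \<open>r = b\<close> this is the cofactor of the second increment when the
    intervals are disjoint, with \<open>r = a'\<close> the cofactor of the part before the
    overlap.\<close>
  have past: "integrable M (\<lambda>\<omega>. X \<omega> * (z r \<omega> - z a \<omega>) * Y \<omega>)"
      "(\<lambda>\<omega>. X \<omega> * (z r \<omega> - z a \<omega>) * Y \<omega>) \<in> borel_measurable (F a')"
    if r: "a \<le> r" "r \<le> a'" for r
  proof -
    note [measurable] = increment_measurable_F[OF ord(1) r]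
    show "(\<lambda>\<omega>. X \<omega> * (z r \<omega> - z a \<omega>) * Y \<omega>) \<in> borel_measurable (F a')" by measurable
    have "(\<lambda>\<omega>. X \<omega> * (z r \<omega> - z a \<omega>)) \<in> borel_measurable (F a')" by measurable
    then show "integrable M (\<lambda>\<omega>. X \<omega> * (z r \<omega> - z a \<omega>) * Y \<omega>)"
      by (intro integrable_mult_power2 increment_mult_power2 Y meas ord r X) (rule measurable_F)
  qed
  show ?thesis
  proof (cases "b \<le> a'")
    case True
    have "expectation (\<lambda>\<omega>. X \<omega> * (z b \<omega> - z a \<omega>) * Y \<omega> * (z b' \<omega> - z a' \<omega>)) = 0"
      by (rule increment_orthogonal[OF _ ord(4)]) (use past[OF ord(2) True] ord in auto)
    then show ?thesis using True ord by (simp add: mult.assoc)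
  next
    case False
    define m where "m = min b b'"
    have m: "a' \<le> m" "m \<le> b" "m \<le> b'" "0 \<le> a'" "0 \<le> m" "m = b \<or> m = b'"
      using False ord by (auto simp: m_def)
    define P where "P \<omega> = X \<omega> * Y \<omega>" for \<omega>
    have P: "P \<in> borel_measurable (F a')" "integrable M P"
      unfolding P_def by (measurable, intro integrable_mult_power2 X Y meas)
    have Pm: "(\<lambda>\<omega>. P \<omega> * (z m \<omega> - z a' \<omega>)) \<in> borel_measurable (F m)"
      by (intro borel_measurable_times measurable_F_mono[OF P(1)] increment_measurable_F) (use m in auto)
    note Pi = increment_orthogonal(1)[OF m(4,1) P]
    note T1 = increment_orthogonal[OF m(4) ord(4) past(2)[OF ord(3) order_refl] past(1)[OF ord(3) order_refl]]
    have T2: "integrable M (\<lambda>\<omega>. P \<omega> * (z m \<omega> - z a' \<omega>)\<^sup>2)"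
       "expectation (\<lambda>\<omega>. P \<omega> * (z m \<omega> - z a' \<omega>)\<^sup>2) = expectation P * (m - a')"
      using increment_indep[OF m(4,1) P, of "\<lambda>x. x\<^sup>2"] increment_moments[OF m(4,1)] by auto
    note T3 = increment_orthogonal[OF m(5,2) Pm Pi]
    note T4 = increment_orthogonal[OF m(5,3) Pm Pi]
    \<comment> \<open>The overlap is the interval from \<open>a'\<close> to \<open>m\<close>. One of
      the last two terms is zero because \<open>m\<close> is \<open>b\<close> or \<open>b'\<close>;
      keeping both avoids a case split. Only the squared increment contributes to the
      expectation.\<close>
    have "X \<omega> * (z b \<omega> - z a \<omega>) * (Y \<omega> * (z b' \<omega> - z a' \<omega>)) =
        X \<omega> * (z a' \<omega> - z a \<omega>) * Y \<omega> * (z b' \<omega> - z a' \<omega>) + P \<omega> * (z m \<omega> - z a' \<omega>)\<^sup>2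
        + P \<omega> * (z m \<omega> - z a' \<omega>) * (z b \<omega> - z m \<omega>)
        + P \<omega> * (z m \<omega> - z a' \<omega>) * (z b' \<omega> - z m \<omega>)" for \<omega>
      using m(6) by (auto simp: P_def power2_eq_square algebra_simps)
    then have "expectation (\<lambda>\<omega>. X \<omega> * (z b \<omega> - z a \<omega>) * (Y \<omega> * (z b' \<omega> - z a' \<omega>))) =
        expectation P * (m - a')"
      using T1 T2 T3 T4 by simp
    then show ?thesis using m ord by (simp add: P_def[abs_def] m_def max_def)
  qed
qed

lemma isometry_pair:
  assumes "0 \<le> a" "a \<le> b" "0 \<le> a'" "a' \<le> b'"
    and X: "X \<in> borel_measurable (F a)" "integrable M (\<lambda>\<omega>. (X \<omega>)\<^sup>2)"
    and Y: "Y \<in> borel_measurable (F a')" "integrable M (\<lambda>\<omega>. (Y \<omega>)\<^sup>2)"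
  shows "expectation (\<lambda>\<omega>. X \<omega> * (z b \<omega> - z a \<omega>) * (Y \<omega> * (z b' \<omega> - z a' \<omega>))) =
    expectation (\<lambda>\<omega>. X \<omega> * Y \<omega>) * max 0 (min b b' - max a a')"
proof (cases "a \<le> a'")
  case True
  then show ?thesis using assms by (intro isometry_pair_ordered)
next
  case False
  then show ?thesis using isometry_pair_ordered[of a' b' a b Y X] assms
    by (simp add: mult.commute min.commute max.commute)
qed

end

lemma integral_indicator_overlap:
  fixes a b a' b' :: real
  assumes "a \<le> b" "a' \<le> b'"
  shows "integrable lborel (\<lambda>s. indicator {a<..b} s * indicator {a'<..b'} s :: real)"
    and "(\<integral>s. indicator {a<..b} s * indicator {a'<..b'} s \<partial>lborel) = max 0 (min b b' - max a a')"
proof -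
  have eq: "(\<lambda>s. indicator {a<..b} s * indicator {a'<..b'} s :: real) =
      indicator {max a a'<..min b b'}"
    by (auto simp: indicator_def fun_eq_iff)
  show "integrable lborel (\<lambda>s. indicator {a<..b} s * indicator {a'<..b'} s :: real)"
    unfolding eq by (cases "max a a' \<le> min b b'") auto
  show "(\<integral>s. indicator {a<..b} s * indicator {a'<..b'} s \<partial>lborel) = max 0 (min b b' - max a a')"
    unfolding eq by (cases "max a a' \<le> min b b'") auto
qed

lemma integral_step_power2:
  fixes a b c :: "'i \<Rightarrow> real"
  assumes "\<And>i. i \<in> S \<Longrightarrow> a i \<le> b i"
  shows "integrable lborel (\<lambda>s. (\<Sum>i\<in>S. c i * indicator {a i<..b i} s)\<^sup>2)"
    and "(\<integral>s. (\<Sum>i\<in>S. c i * indicator {a i<..b i} s)\<^sup>2 \<partial>lborel) =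
      (\<Sum>i\<in>S. \<Sum>j\<in>S. c i * c j * max 0 (min (b i) (b j) - max (a i) (a j)))"
proof -
  have eq: "(\<Sum>i\<in>S. c i * indicator {a i<..b i} s)\<^sup>2 =
      (\<Sum>i\<in>S. \<Sum>j\<in>S. c i * c j * (indicator {a i<..b i} s * indicator {a j<..b j} s))" for s
    by (simp add: power2_eq_square sum_product mult_ac)
  note I = integral_indicator_overlap[OF assms assms]
  show "integrable lborel (\<lambda>s. (\<Sum>i\<in>S. c i * indicator {a i<..b i} s)\<^sup>2)"
    unfolding eq by (intro Bochner_Integration.integrable_sum integrable_mult_right I)
  show "(\<integral>s. (\<Sum>i\<in>S. c i * indicator {a i<..b i} s)\<^sup>2 \<partial>lborel) =
     (\<Sum>i\<in>S. \<Sum>j\<in>S. c i * c j * max 0 (min (b i) (b j) - max (a i) (a j)))"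
    unfolding eq using I
    by (simp add: Bochner_Integration.integral_sum Bochner_Integration.integrable_sum)
qed

context wiener
begin

text \<open>Both sides expand to the same double sum over pairs of intervals. The overlap length
  comes from \<open>isometry_pair\<close> on the left and from the Lebesgue measure of the
  intersection on the right.\<close>

lemma ito_isometry:
  fixes a b :: "'i \<Rightarrow> real"
  assumes ord: "\<And>i. i \<in> S \<Longrightarrow> 0 \<le> a i \<and> a i \<le> b i"
    and X: "\<And>i. i \<in> S \<Longrightarrow> X i \<in> borel_measurable (F (a i))"
      "\<And>i. i \<in> S \<Longrightarrow> integrable M (\<lambda>\<omega>. (X i \<omega>)\<^sup>2)"
  shows "(\<integral>\<^sup>+\<omega>. ennreal ((\<Sum>i\<in>S. X i \<omega> * (z (b i) \<omega> - z (a i) \<omega>))\<^sup>2) \<partial>M) =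
    (\<integral>\<^sup>+\<omega>. (\<integral>\<^sup>+s. ennreal ((\<Sum>i\<in>S. X i \<omega> * indicator {a i<..b i} s)\<^sup>2) \<partial>lborel) \<partial>M)"
proof -
  define D where "D i \<omega> = X i \<omega> * (z (b i) \<omega> - z (a i) \<omega>)" for i \<omega>
  define m where "m i j = max 0 (min (b i) (b j) - max (a i) (a j))" for i j
  have Dm: "i \<in> S \<Longrightarrow> D i \<in> borel_measurable M" for i
    unfolding D_def using ord[of i] by (auto intro!: borel_measurable_times measurable_F[OF X(1)] z_measurable borel_measurable_diff)
  have D2: "i \<in> S \<Longrightarrow> integrable M (\<lambda>\<omega>. (D i \<omega>)\<^sup>2)" for i
    unfolding D_def by (intro increment_mult_power2 X) (use ord in auto)
  have DD: "i \<in> S \<Longrightarrow> j \<in> S \<Longrightarrow> integrable M (\<lambda>\<omega>. D i \<omega> * D j \<omega>)" for i j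
    by (intro integrable_mult_power2 Dm D2)
  have XX: "i \<in> S \<Longrightarrow> j \<in> S \<Longrightarrow> integrable M (\<lambda>\<omega>. X i \<omega> * X j \<omega>)" for i j
    by (intro integrable_mult_power2 measurable_F[OF X(1)] X(2))
  have XXm: "i \<in> S \<Longrightarrow> j \<in> S \<Longrightarrow> integrable M (\<lambda>\<omega>. X i \<omega> * X j \<omega> * m i j)" for i j
    by (intro integrable_mult_left XX)
  have pair: "i \<in> S \<Longrightarrow> j \<in> S \<Longrightarrow>
      expectation (\<lambda>\<omega>. D i \<omega> * D j \<omega>) = expectation (\<lambda>\<omega>. X i \<omega> * X j \<omega> * m i j)" for i j
    unfolding D_def using isometry_pair[of "a i" "b i" "a j" "b j" "X i" "X j"] ord[of i] ord[of j] X
    by (simp add: m_def)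
  have sq: "(\<Sum>i\<in>S. D i \<omega>)\<^sup>2 = (\<Sum>i\<in>S. \<Sum>j\<in>S. D i \<omega> * D j \<omega>)" for \<omega>
    by (simp add: power2_eq_square sum_product)
  have step: "integrable lborel (\<lambda>s. (\<Sum>i\<in>S. X i \<omega> * indicator {a i<..b i} s)\<^sup>2)"
      "(\<integral>s. (\<Sum>i\<in>S. X i \<omega> * indicator {a i<..b i} s)\<^sup>2 \<partial>lborel) =
       (\<Sum>i\<in>S. \<Sum>j\<in>S. X i \<omega> * X j \<omega> * m i j)" for \<omega>
    unfolding m_def using ord by (intro integral_step_power2; simp)+
  have inner: "(\<integral>\<^sup>+s. ennreal ((\<Sum>i\<in>S. X i \<omega> * indicator {a i<..b i} s)\<^sup>2) \<partial>lborel) =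
      ennreal (\<Sum>i\<in>S. \<Sum>j\<in>S. X i \<omega> * X j \<omega> * m i j)" for \<omega>
    by (subst nn_integral_eq_integral) (simp_all only: step, auto)
  have nn: "0 \<le> (\<Sum>i\<in>S. \<Sum>j\<in>S. X i \<omega> * X j \<omega> * m i j)" for \<omega>
    unfolding step(2)[symmetric] by (rule integral_nonneg_AE) auto
  have "(\<integral>\<^sup>+\<omega>. ennreal ((\<Sum>i\<in>S. D i \<omega>)\<^sup>2) \<partial>M) = ennreal (expectation (\<lambda>\<omega>. (\<Sum>i\<in>S. D i \<omega>)\<^sup>2))"
    by (intro nn_integral_eq_integral) (simp add: sq Bochner_Integration.integrable_sum DD, simp)
  also have "expectation (\<lambda>\<omega>. (\<Sum>i\<in>S. D i \<omega>)\<^sup>2) = (\<Sum>i\<in>S. \<Sum>j\<in>S. expectation (\<lambda>\<omega>. X i \<omega> * X j \<omega> * m i j))"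
    unfolding sq using DD pair
    by (simp add: Bochner_Integration.integral_sum Bochner_Integration.integrable_sum)
  also have "\<dots> = expectation (\<lambda>\<omega>. \<Sum>i\<in>S. \<Sum>j\<in>S. X i \<omega> * X j \<omega> * m i j)"
    using XXm by (simp add: Bochner_Integration.integral_sum Bochner_Integration.integrable_sum)
  also have "ennreal \<dots> = (\<integral>\<^sup>+\<omega>. ennreal (\<Sum>i\<in>S. \<Sum>j\<in>S. X i \<omega> * X j \<omega> * m i j) \<partial>M)"
    by (intro nn_integral_eq_integral[symmetric]) (use nn in \<open>auto intro!: Bochner_Integration.integrable_sum XXm\<close>)
  finally show ?thesis by (simp add: D_def inner)
qed

end

section \<open>Uniqueness of the Ito integral\<close>

lemma ennreal_power2_triangle:
  "ennreal (((x::real) - y)\<^sup>2) \<le> 2 * (ennreal ((w - x)\<^sup>2) + ennreal ((w - y)\<^sup>2))"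
proof -
  have "0 \<le> ((w - x) + (w - y))\<^sup>2" by simp
  then have "(x - y)\<^sup>2 \<le> 2 * ((w - x)\<^sup>2 + (w - y)\<^sup>2)"
    by (simp add: power2_eq_square algebra_simps)
  then have "ennreal ((x - y)\<^sup>2) \<le> ennreal (2 * ((w - x)\<^sup>2 + (w - y)\<^sup>2))"
    by (rule ennreal_leI)
  then show ?thesis
    by (simp add: ennreal_mult ennreal_plus)
qed

context wiener
begin

text \<open>Monotonicity is prescribed step by step and the bounds only at the two ends, so the
  lower bound is carried upwards by induction and the upper bound downwards.\<close>

lemma elementary_process_bounds:
  assumes "elementary_process M F T n \<tau> \<xi>" "i < n"
  shows "0 \<le> \<tau> i \<and> \<tau> i \<le> \<tau> (Suc i) \<and> \<tau> (Suc i) \<le> T"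
proof -
  have step: "j < n \<Longrightarrow> \<tau> j \<le> \<tau> (Suc j)" for j
    using assms by (simp add: elementary_process_def)
  have "0 \<le> \<tau> j" if "j \<le> n" for j
    using that
  proof (induction j)
    case 0
    then show ?case using assms by (simp add: elementary_process_def)
  next
    case (Suc j)
    then show ?case using step[of j] by simp
  qed
  moreover have "\<tau> j \<le> T" if "j \<le> n" for j
    using that
  proof (induction j rule: inc_induct)
    case base
    then show ?case using assms by (simp add: elementary_process_def)
  next
    case (step j)
    then show ?case using \<open>\<And>j. j < n \<Longrightarrow> \<tau> j \<le> \<tau> (Suc j)\<close>[of j] by simp
  qed
  ultimately show ?thesis using step assms(2) by simp
qed

lemma elementary_integral_measurable:
  assumes "elementary_process M F T n \<tau> \<xi>"
  shows "elementary_integral z n \<tau> \<xi> \<in> borel_measurable M"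
proof -
  have "i < n \<Longrightarrow> \<xi> i \<in> borel_measurable M" for i
    using assms by (auto simp: elementary_process_def intro: measurable_F)
  moreover have "i < n \<Longrightarrow> z (\<tau> i) \<in> borel_measurable M \<and> z (\<tau> (Suc i)) \<in> borel_measurable M" for i
    using elementary_process_bounds[OF assms, of i] by (auto intro!: z_measurable)
  ultimately show ?thesis
    unfolding elementary_integral_def[abs_def]
    by (intro borel_measurable_sum borel_measurable_times borel_measurable_diff) auto
qed

lemma elementary_value_measurable:
  assumes "elementary_process M F T n \<tau> \<xi>"
  shows "(\<lambda>(s, \<omega>). elementary_value n \<tau> \<xi> s \<omega>) \<in> borel_measurable (restrict_space lborel {0..T} \<Otimes>\<^sub>M M)"
proof -
  have [measurable]: "fst \<in> borel_measurable (restrict_space lborel {0..T} \<Otimes>\<^sub>M M)"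
    by (rule measurable_compose[OF measurable_fst]) (rule measurable_restrict_space1, simp)
  have "(\<lambda>p. \<xi> i (snd p) * indicator {\<tau> i<..\<tau> (Suc i)} (fst p)) \<in>
      borel_measurable (restrict_space lborel {0..T} \<Otimes>\<^sub>M M)" if "i < n" for i
  proof -
    have [measurable]: "\<xi> i \<in> borel_measurable M"
      using assms that by (auto simp: elementary_process_def intro: measurable_F)
    show ?thesis by measurable
  qed
  then show ?thesis
    unfolding elementary_value_def split_beta' by (intro borel_measurable_sum) auto
qed

text \<open>The difference of two elementary integrals is a sum over the disjoint union of the two index
  sets, with overlapping intervals; so no common refinement of the partitions is needed.\<close>

lemma elementary_difference_isometry:
  assumes E: "elementary_process M F T n \<tau> \<xi>" and E': "elementary_process M F T n' \<tau>' \<xi>'"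
  shows "(\<integral>\<^sup>+\<omega>. ennreal ((elementary_integral z n \<tau> \<xi> \<omega> - elementary_integral z n' \<tau>' \<xi>' \<omega>)\<^sup>2) \<partial>M) =
    (\<integral>\<^sup>+\<omega>. (\<integral>\<^sup>+s. ennreal ((elementary_value n \<tau> \<xi> s \<omega> - elementary_value n' \<tau>' \<xi>' s \<omega>)\<^sup>2)
       \<partial>restrict_space lborel {0..T}) \<partial>M)"
proof -
  define S where "S = {..<n} <+> {..<n'}"
  define a where "a = case_sum \<tau> \<tau>'"
  define b where "b = case_sum (\<lambda>i. \<tau> (Suc i)) (\<lambda>i. \<tau>' (Suc i))"
  define X where "X = case_sum \<xi> (\<lambda>i \<omega>. - \<xi>' i \<omega>)"
  have int: "(\<Sum>i\<in>S. X i \<omega> * (z (b i) \<omega> - z (a i) \<omega>)) =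
      elementary_integral z n \<tau> \<xi> \<omega> - elementary_integral z n' \<tau>' \<xi>' \<omega>" for \<omega>
    by (simp add: S_def a_def b_def X_def sum.Plus elementary_integral_def sum_negf)
  have val: "(\<Sum>i\<in>S. X i \<omega> * indicator {a i<..b i} s) =
      elementary_value n \<tau> \<xi> s \<omega> - elementary_value n' \<tau>' \<xi>' s \<omega>" for s \<omega>
    by (simp only: S_def a_def b_def X_def sum.Plus[OF finite_lessThan finite_lessThan] sum.case comp_def
        elementary_value_def mult_minus_left sum_negf diff_conv_add_uminus)
  have ord: "0 \<le> a i \<and> a i \<le> b i \<and> b i \<le> T" if "i \<in> S" for i
    using that elementary_process_bounds[OF E] elementary_process_bounds[OF E']
    by (auto simp: S_def a_def b_def)
  have X: "X i \<in> borel_measurable (F (a i)) \<and> integrable M (\<lambda>\<omega>. (X i \<omega>)\<^sup>2)" if "i \<in> S" for i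
    using that E E' by (auto simp: S_def a_def X_def elementary_process_def)
  \<comment> \<open>The isometry integrates over the whole line, the definition of the Ito integral
    only over \<open>{0..T}\<close>; the two agree because the step functions vanish
    outside.\<close>
  have outside: "(\<Sum>i\<in>S. X i \<omega> * indicator {a i<..b i} s) = 0" if "s \<notin> {0..T}" for s \<omega>
    using ord that by (intro sum.neutral) (fastforce simp: indicator_def)
  have "(\<integral>\<^sup>+s. ennreal ((\<Sum>i\<in>S. X i \<omega> * indicator {a i<..b i} s)\<^sup>2) \<partial>lborel) =
     (\<integral>\<^sup>+s. ennreal ((\<Sum>i\<in>S. X i \<omega> * indicator {a i<..b i} s)\<^sup>2) \<partial>restrict_space lborel {0..T})" for \<omega>
  proof (subst nn_integral_restrict_space)
    have "ennreal ((\<Sum>i\<in>S. X i \<omega> * indicator {a i<..b i} s)\<^sup>2) =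
      ennreal ((\<Sum>i\<in>S. X i \<omega> * indicator {a i<..b i} s)\<^sup>2) * indicator {0..T} s" for s
    proof (cases "s \<in> {0..T}")
      case False
      show ?thesis by (simp only: outside[OF False]) simp
    qed simp
    then show "(\<integral>\<^sup>+s. ennreal ((\<Sum>i\<in>S. X i \<omega> * indicator {a i<..b i} s)\<^sup>2) \<partial>lborel) =
      (\<integral>\<^sup>+s\<in>{0..T}. ennreal ((\<Sum>i\<in>S. X i \<omega> * indicator {a i<..b i} s)\<^sup>2) \<partial>lborel)"
      by (rule nn_integral_cong)
  qed simp
  then show ?thesis
    using ito_isometry[of S a b X] ord X by (simp add: int val)
qed

text \<open>By the isometry the distance of the two elementary integrals equals that of their
  integrands, and both integrands approximate the same \<open>H\<close>.\<close>

lemma has_ito_integral_unique: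
  assumes I: "has_ito_integral M F z T H I" and I': "has_ito_integral M F z T H I'"
  shows "AE \<omega> in M. I \<omega> = I' \<omega>"
proof -
  define R where "R = restrict_space lborel {0..T}"
  interpret R: finite_measure R
    unfolding R_def by (rule finite_measure_restrict_space_Icc)
  obtain n \<tau> \<xi> where E: "\<And>k. elementary_process M F T (n k) (\<tau> k) (\<xi> k)"
    and V: "(\<lambda>k. \<integral>\<^sup>+\<omega>. (\<integral>\<^sup>+s\<in>{0..T}.
            ennreal ((H s \<omega> - elementary_value (n k) (\<tau> k) (\<xi> k) s \<omega>)\<^sup>2) \<partial>lborel) \<partial>M) \<longlonglongrightarrow> 0"
    and L: "(\<lambda>k. \<integral>\<^sup>+\<omega>. ennreal ((I \<omega> - elementary_integral z (n k) (\<tau> k) (\<xi> k) \<omega>)\<^sup>2) \<partial>M) \<longlonglongrightarrow> 0"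
    using I unfolding has_ito_integral_def by blast
  obtain n' \<tau>' \<xi>' where E': "\<And>k. elementary_process M F T (n' k) (\<tau>' k) (\<xi>' k)"
    and V': "(\<lambda>k. \<integral>\<^sup>+\<omega>. (\<integral>\<^sup>+s\<in>{0..T}.
            ennreal ((H s \<omega> - elementary_value (n' k) (\<tau>' k) (\<xi>' k) s \<omega>)\<^sup>2) \<partial>lborel) \<partial>M) \<longlonglongrightarrow> 0"
    and L': "(\<lambda>k. \<integral>\<^sup>+\<omega>. ennreal ((I' \<omega> - elementary_integral z (n' k) (\<tau>' k) (\<xi>' k) \<omega>)\<^sup>2) \<partial>M) \<longlonglongrightarrow> 0"
    using I' unfolding has_ito_integral_def by blast
  have [measurable]: "I \<in> borel_measurable M" "I' \<in> borel_measurable M"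
    using I I' by (auto simp: has_ito_integral_def)
  have H [measurable]: "(\<lambda>(s, \<omega>). H s \<omega>) \<in> borel_measurable (R \<Otimes>\<^sub>M M)"
    using I by (auto simp: has_ito_integral_def R_def)
  define J J' where "J k = elementary_integral z (n k) (\<tau> k) (\<xi> k)"
    and "J' k = elementary_integral z (n' k) (\<tau>' k) (\<xi>' k)" for k
  define G G' where "G k = elementary_value (n k) (\<tau> k) (\<xi> k)"
    and "G' k = elementary_value (n' k) (\<tau>' k) (\<xi>' k)" for k
  have [measurable]: "J k \<in> borel_measurable M" "J' k \<in> borel_measurable M" for k
    unfolding J_def J'_def using elementary_integral_measurable E E' by auto
  have [measurable]: "(\<lambda>(s, \<omega>). G k s \<omega>) \<in> borel_measurable (R \<Otimes>\<^sub>M M)"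
     "(\<lambda>(s, \<omega>). G' k s \<omega>) \<in> borel_measurable (R \<Otimes>\<^sub>M M)" for k
    unfolding R_def G_def G'_def using elementary_value_measurable E E' by auto
  define d where "d G = (\<integral>\<^sup>+\<omega>. (\<integral>\<^sup>+s. ennreal ((H s \<omega> - G s \<omega>)\<^sup>2) \<partial>R) \<partial>M)" for G
  have V: "(\<lambda>k. d (G k)) \<longlonglongrightarrow> 0" and V': "(\<lambda>k. d (G' k)) \<longlonglongrightarrow> 0"
    using V V' by (simp_all add: d_def R_def G_def G'_def nn_integral_restrict_space)
  define c where "c k = (\<integral>\<^sup>+\<omega>. ennreal ((I \<omega> - J k \<omega>)\<^sup>2) \<partial>M)" for k
  define c' where "c' k = (\<integral>\<^sup>+\<omega>. ennreal ((I' \<omega> - J' k \<omega>)\<^sup>2) \<partial>M)" for k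
  have inner_meas: "(\<lambda>\<omega>. \<integral>\<^sup>+s. ennreal ((H s \<omega> - g s \<omega>)\<^sup>2) \<partial>R) \<in> borel_measurable M"
    if "(\<lambda>(s, \<omega>). g s \<omega>) \<in> borel_measurable (R \<Otimes>\<^sub>M M)" for g
  proof (rule R.borel_measurable_nn_integral)
    have "(\<lambda>(s, \<omega>). ennreal ((H s \<omega> - g s \<omega>)\<^sup>2)) \<in> borel_measurable (R \<Otimes>\<^sub>M M)"
      using H that by (simp add: split_beta')
    from measurable_pair_swap[OF this]
    show "(\<lambda>(\<omega>, s). ennreal ((H s \<omega> - g s \<omega>)\<^sup>2)) \<in> borel_measurable (M \<Otimes>\<^sub>M R)"
      by simp
  qed
  have JJ: "(\<integral>\<^sup>+\<omega>. ennreal ((J k \<omega> - J' k \<omega>)\<^sup>2) \<partial>M) \<le> 2 * (d (G k) + d (G' k))" for k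
  proof -
    have sm: "(\<lambda>s. ennreal ((H s \<omega> - g s \<omega>)\<^sup>2)) \<in> borel_measurable R"
      if "(\<lambda>(s, \<omega>). g s \<omega>) \<in> borel_measurable (R \<Otimes>\<^sub>M M)" "\<omega> \<in> space M" for g \<omega>
      using measurable_Pair1[OF H that(2)] measurable_Pair1[OF that] by simp
    have "(\<integral>\<^sup>+\<omega>. ennreal ((J k \<omega> - J' k \<omega>)\<^sup>2) \<partial>M) =
       (\<integral>\<^sup>+\<omega>. (\<integral>\<^sup>+s. ennreal ((G k s \<omega> - G' k s \<omega>)\<^sup>2) \<partial>R) \<partial>M)"
      unfolding J_def J'_def G_def G'_def R_def by (rule elementary_difference_isometry[OF E E'])
    also have "\<dots> \<le> (\<integral>\<^sup>+\<omega>. (\<integral>\<^sup>+s. 2 * (ennreal ((H s \<omega> - G k s \<omega>)\<^sup>2) + ennreal ((H s \<omega> - G' k s \<omega>)\<^sup>2)) \<partial>R) \<partial>M)"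
      by (intro nn_integral_mono ennreal_power2_triangle)
    also have "\<dots> = (\<integral>\<^sup>+\<omega>. 2 * ((\<integral>\<^sup>+s. ennreal ((H s \<omega> - G k s \<omega>)\<^sup>2) \<partial>R) +
        (\<integral>\<^sup>+s. ennreal ((H s \<omega> - G' k s \<omega>)\<^sup>2) \<partial>R)) \<partial>M)"
      by (intro nn_integral_cong) (simp add: nn_integral_cmult nn_integral_add sm)
    also have "\<dots> = 2 * (d (G k) + d (G' k))"
      by (simp add: nn_integral_cmult nn_integral_add inner_meas d_def)
    finally show ?thesis .
  qed
  \<comment> \<open>Two triangle steps lead from \<open>I\<close> through \<open>J k\<close> and
    \<open>J' k\<close> to \<open>I'\<close>. The middle distance is controlled by
    \<open>JJ\<close>, and each term on the right tends to 0.\<close>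
  have le: "(\<integral>\<^sup>+\<omega>. ennreal ((I \<omega> - I' \<omega>)\<^sup>2) \<partial>M) \<le> 2 * (c k + 2 * (2 * (d (G k) + d (G' k)) + c' k))" for k
  proof -
    have "ennreal ((I \<omega> - I' \<omega>)\<^sup>2) \<le> 2 * (ennreal ((I \<omega> - J k \<omega>)\<^sup>2) +
        2 * (ennreal ((J k \<omega> - J' k \<omega>)\<^sup>2) + ennreal ((I' \<omega> - J' k \<omega>)\<^sup>2)))" for \<omega>
    proof -
      have "ennreal ((I \<omega> - I' \<omega>)\<^sup>2) \<le> 2 * (ennreal ((I \<omega> - J k \<omega>)\<^sup>2) + ennreal ((J k \<omega> - I' \<omega>)\<^sup>2))"
        using ennreal_power2_triangle[of "I \<omega>" "I' \<omega>" "J k \<omega>"] by (simp add: power2_commute)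
      also have "ennreal ((J k \<omega> - I' \<omega>)\<^sup>2) \<le>
          2 * (ennreal ((J k \<omega> - J' k \<omega>)\<^sup>2) + ennreal ((I' \<omega> - J' k \<omega>)\<^sup>2))"
        using ennreal_power2_triangle[of "J k \<omega>" "I' \<omega>" "J' k \<omega>"] by (simp add: power2_commute)
      finally show ?thesis by (simp add: mult_left_mono add_left_mono)
    qed
    then have "(\<integral>\<^sup>+\<omega>. ennreal ((I \<omega> - I' \<omega>)\<^sup>2) \<partial>M) \<le> (\<integral>\<^sup>+\<omega>. 2 * (ennreal ((I \<omega> - J k \<omega>)\<^sup>2) +
        2 * (ennreal ((J k \<omega> - J' k \<omega>)\<^sup>2) + ennreal ((I' \<omega> - J' k \<omega>)\<^sup>2))) \<partial>M)"
      by (intro nn_integral_mono)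
    also have "\<dots> = 2 * (c k + 2 * ((\<integral>\<^sup>+\<omega>. ennreal ((J k \<omega> - J' k \<omega>)\<^sup>2) \<partial>M) + c' k))"
      by (simp add: nn_integral_cmult nn_integral_add c_def c'_def)
    also have "\<dots> \<le> 2 * (c k + 2 * (2 * (d (G k) + d (G' k)) + c' k))"
      by (intro mult_left_mono add_left_mono add_right_mono JJ) auto
    finally show ?thesis .
  qed
  have "(\<lambda>k. 2 * (c k + 2 * (2 * (d (G k) + d (G' k)) + c' k))) \<longlonglongrightarrow> 2 * (0 + 2 * (2 * (0 + 0) + 0))"
    using L L' by (intro tendsto_add ennreal_tendsto_cmult V V') (auto simp: c_def c'_def J_def J'_def)
  then have "(\<integral>\<^sup>+\<omega>. ennreal ((I \<omega> - I' \<omega>)\<^sup>2) \<partial>M) \<le> 0"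
    by (intro LIMSEQ_le_const[where X = "\<lambda>k. 2 * (c k + 2 * (2 * (d (G k) + d (G' k)) + c' k))"]) (use le in auto)
  then have "AE \<omega> in M. ennreal ((I \<omega> - I' \<omega>)\<^sup>2) = 0"
    by (subst nn_integral_0_iff_AE[symmetric]) auto
  then show ?thesis
    by eventually_elim (simp add: ennreal_eq_0_iff)
qed

end

subsection \<open>The Ornstein-Uhlenbeck process\<close>

lemma LINT_FTC:
  fixes g G :: "real \<Rightarrow> real"
  assumes "a \<le> b" "continuous_on {a..b} g"
    and "\<And>s. s \<in> {a..b} \<Longrightarrow> (G has_real_derivative g s) (at s within {a..b})"
  shows "(LINT s:{a..b}|lborel. g s) = G b - G a"
proof -
  have "(g has_integral G b - G a) {a..b}"
    by (rule fundamental_theorem_of_calculus)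
      (use assms in \<open>auto simp: has_real_derivative_iff_has_vector_derivative\<close>)
  then show ?thesis
    using set_borel_integral_eq_integral(2)[OF borel_integrable_atLeastAtMost'[OF assms(2)]]
    by (simp add: integral_unique)
qed

lemma LINT_combine:
  fixes g :: "real \<Rightarrow> real"
  assumes "a \<le> b" "b \<le> c" "continuous_on {a..c} g"
  shows "(LINT s:{a..c}|lborel. g s) = (LINT s:{a..b}|lborel. g s) + (LINT s:{b..c}|lborel. g s)"
proof -
  have "continuous_on {a..b} g" "continuous_on {b..c} g"
    using assms by (auto elim: continuous_on_subset)
  then have "(LINT s:{u..v}|lborel. g s) = integral {u..v} g" if "(u, v) \<in> {(a, b), (b, c), (a, c)}" for u v
    using that assms by (intro set_borel_integral_eq_integral borel_integrable_atLeastAtMost') auto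
  then show ?thesis
    using Henstock_Kurzweil_Integration.integral_combine[OF assms(1,2) integrable_continuous_real[OF assms(3)]] by simp
qed

text \<open>Variation of constants, integrated by parts along the path because \<open>w\<close> need
  not be differentiable. Only differences of \<open>w\<close> remain under the integral.\<close>

lemma linear_integral_equation_solution:
  fixes x w :: "real \<Rightarrow> real"
  assumes "0 \<le> t" and x: "continuous_on {0..t} x" and w: "continuous_on {0..t} w"
    and eq: "\<And>s. s \<in> {0..t} \<Longrightarrow> x s = w s - \<alpha> * (LINT r:{0..s}|lborel. x r)"
  shows "x t = exp (- \<alpha> * t) * w t + (LINT s:{0..t}|lborel. \<alpha> * exp (- \<alpha> * (t - s)) * (w t - w s))"
proof -
  have I: "(LINT r:{0..s}|lborel. x r) = integral {0..s} x" if "s \<in> {0..t}" for s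
    using that by (intro set_borel_integral_eq_integral borel_integrable_atLeastAtMost' continuous_on_subset[OF x]) auto
  \<comment> \<open>In the derivative of \<open>G\<close> the exponential multiplies
    \<open>w t\<close> minus \<open>x s + \<alpha> * integral {0..s} x\<close>, and the equation
    identifies the latter with \<open>w s\<close>. The end values are \<open>x t\<close> and
    \<open>exp (- \<alpha> * t) * w t\<close>.\<close>
  define G where "G s = exp (- \<alpha> * (t - s)) * (w t - \<alpha> * integral {0..s} x)" for s
  have "(LINT s:{0..t}|lborel. \<alpha> * exp (- \<alpha> * (t - s)) * (w t - w s)) = G t - G 0"
  proof (rule LINT_FTC)
    fix s assume s: "s \<in> {0..t}"
    have "((\<lambda>u. integral {0..u} x) has_real_derivative x s) (at s within {0..t})"
      using integral_has_vector_derivative[OF x s] by (simp add: has_real_derivative_iff_has_vector_derivative)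
    then show "(G has_real_derivative \<alpha> * exp (- \<alpha> * (t - s)) * (w t - w s)) (at s within {0..t})"
      unfolding G_def using eq[OF s] I[OF s]
      by (auto intro!: derivative_eq_intros simp: algebra_simps)
  qed (use assms in \<open>auto intro!: continuous_intros\<close>)
  moreover have "G t = x t"
    using eq[of t] I[of t] assms(1) by (simp add: G_def)
  ultimately show ?thesis
    by (simp add: G_def)
qed

text \<open>The first bound makes Jensen's inequality applicable. The second absorbs the factor
  \<open>(t - s)\<^sup>2\<close> in the fourth moment of a Wiener increment, uniformly in
  \<open>t\<close>.\<close>

lemma exponential_weight:
  fixes t \<alpha> :: real
  assumes "0 \<le> t" "0 < \<alpha>"
  shows "(LINT s:{0..t}|lborel. \<alpha> * exp (- \<alpha> * (t - s))) \<le> 1"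
    and "(LINT s:{0..t}|lborel. \<alpha> * exp (- \<alpha> * (t - s)) * (t - s)\<^sup>2) \<le> 2 / \<alpha>\<^sup>2"
proof -
  have "(LINT s:{0..t}|lborel. \<alpha> * exp (- \<alpha> * (t - s))) = exp (- \<alpha> * (t - t)) - exp (- \<alpha> * (t - 0))"
    by (rule LINT_FTC[where G = "\<lambda>s. exp (- \<alpha> * (t - s))"]) (use assms in \<open>auto intro!: continuous_intros derivative_eq_intros\<close>)
  then show "(LINT s:{0..t}|lborel. \<alpha> * exp (- \<alpha> * (t - s))) \<le> 1"
    by simp
  \<comment> \<open>The antiderivative obtained by integrating by parts twice; its value at
    \<open>s = t\<close> is exactly the claimed bound.\<close>
  define G where "G s = exp (- \<alpha> * (t - s)) * ((t - s)\<^sup>2 + 2 * (t - s) / \<alpha> + 2 / \<alpha>\<^sup>2)" for s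
  have "(LINT s:{0..t}|lborel. \<alpha> * exp (- \<alpha> * (t - s)) * (t - s)\<^sup>2) = G t - G 0"
  proof (rule LINT_FTC)
    fix s
    show "(G has_real_derivative \<alpha> * exp (- \<alpha> * (t - s)) * (t - s)\<^sup>2) (at s within {0..t})"
      unfolding G_def using assms
      by (auto intro!: derivative_eq_intros simp: field_simps power2_eq_square)
  qed (use assms in \<open>auto intro!: continuous_intros\<close>)
  moreover have "0 \<le> G 0"
    using assms by (simp add: G_def)
  ultimately show "(LINT s:{0..t}|lborel. \<alpha> * exp (- \<alpha> * (t - s)) * (t - s)\<^sup>2) \<le> 2 / \<alpha>\<^sup>2"
    by (simp add: G_def)
qed

lemma power4_add_le: "(a + b) ^ 4 \<le> 8 * (a ^ 4 + b ^ 4)" for a b :: real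
proof -
  have sq: "(u + v)\<^sup>2 \<le> 2 * (u\<^sup>2 + v\<^sup>2)" for u v :: real
    using zero_le_power2[of "u - v"] by (simp add: power2_eq_square algebra_simps)
  have "((a + b)\<^sup>2)\<^sup>2 \<le> (2 * (a\<^sup>2 + b\<^sup>2))\<^sup>2"
    by (intro power_mono sq) auto
  also have "\<dots> \<le> 4 * (2 * ((a\<^sup>2)\<^sup>2 + (b\<^sup>2)\<^sup>2))"
    unfolding power_mult_distrib using sq[of "a\<^sup>2" "b\<^sup>2"] by simp
  finally show ?thesis by simp
qed

text \<open>A pointwise substitute for Cauchy-Schwarz under the expectation. The weight balances
  factors of unequal size: for \<open>p\<close> of order h and \<open>q\<close> of order sqrt h both
  summands are of order h^3, for \<open>p\<close> of order sqrt h and \<open>q\<close> of order 1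
  both are of order h.\<close>

lemma mult_power2_le:
  assumes "0 < (h::real)"
  shows "(p * q)\<^sup>2 \<le> (1 / h * p ^ 4 + h * q ^ 4) / 2"
proof -
  have "0 \<le> (p\<^sup>2 - h * q\<^sup>2)\<^sup>2 / h" using assms by simp
  also have "\<dots> = 1 / h * p ^ 4 + h * q ^ 4 - 2 * (p * q)\<^sup>2"
    using assms by (simp add: power2_eq_square field_simps eval_nat_numeral)
  finally show ?thesis by simp
qed

section \<open>Fourth moments of the process and of its increments\<close>

locale ou_process = wiener M F z
  for M :: "'a measure" and F z +
  fixes x :: "real \<Rightarrow> 'a \<Rightarrow> real" and \<alpha> \<sigma> :: real
  assumes ou: "ornstein_uhlenbeck M F z \<alpha> \<sigma> x"
    and \<alpha>_pos: "0 < \<alpha>"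
    and x0_power4: "integrable M (\<lambda>\<omega>. x 0 \<omega> ^ 4)"
begin

lemma x_measurable_F: "0 \<le> t \<Longrightarrow> x t \<in> borel_measurable (F t)"
  using ou by (simp add: ornstein_uhlenbeck_def)

lemma x_measurable: "0 \<le> t \<Longrightarrow> x t \<in> borel_measurable M"
  by (rule measurable_F[OF x_measurable_F])

lemma x_continuous: "\<omega> \<in> space M \<Longrightarrow> 0 \<le> a \<Longrightarrow> continuous_on {a..b} (\<lambda>s. x s \<omega>)"
  using ou by (auto simp: ornstein_uhlenbeck_def elim!: continuous_on_subset dest!: bspec)

lemma z_continuous: "\<omega> \<in> space M \<Longrightarrow> 0 \<le> a \<Longrightarrow> continuous_on {a..b} (\<lambda>s. z s \<omega>)"
  using wiener by (auto simp: wiener_process_def elim!: continuous_on_subset dest!: bspec)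

lemma drift_measurable:
  "0 \<le> r \<Longrightarrow> r \<le> s \<Longrightarrow> (\<lambda>\<omega>. LINT u:{r..s}|lborel. x u \<omega>) \<in> borel_measurable M"
  by (intro borel_measurable_path_integral x_measurable x_continuous) auto

lemma x_eq: "AE \<omega> in M. \<forall>t\<ge>0. x t \<omega> = x 0 \<omega> - \<alpha> * (LINT s:{0..t}|lborel. x s \<omega>) + \<sigma> * z t \<omega>"
  proof -
  have "(LINT s:{0..t}|lborel. - \<alpha> * x s \<omega>) = - \<alpha> * (LINT s:{0..t}|lborel. x s \<omega>)" for t \<omega>
    by (rule set_integral_mult_right)
  then show ?thesis
    using ou by (simp only: ornstein_uhlenbeck_def) simp
qed

lemma x_increment:
  "AE \<omega> in M. \<forall>r s. 0 \<le> r \<and> r \<le> s \<longrightarrow>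
     x s \<omega> - x r \<omega> = - \<alpha> * (LINT u:{r..s}|lborel. x u \<omega>) + \<sigma> * (z s \<omega> - z r \<omega>)"
  using x_eq AE_space
proof eventually_elim
  case (elim \<omega>)
  show ?case
  proof (intro allI impI, elim conjE)
    fix r s :: real assume rs: "0 \<le> r" "r \<le> s"
    have "(LINT u:{0..s}|lborel. x u \<omega>) = (LINT u:{0..r}|lborel. x u \<omega>) + (LINT u:{r..s}|lborel. x u \<omega>)"
      by (rule LINT_combine) (use rs x_continuous[OF elim(2)] in auto)
    moreover have "x s \<omega> = x 0 \<omega> - \<alpha> * (LINT u:{0..s}|lborel. x u \<omega>) + \<sigma> * z s \<omega>"
       "x r \<omega> = x 0 \<omega> - \<alpha> * (LINT u:{0..r}|lborel. x u \<omega>) + \<sigma> * z r \<omega>"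
      using elim(1) rs order_trans by blast+
    ultimately show "x s \<omega> - x r \<omega> = - \<alpha> * (LINT u:{r..s}|lborel. x u \<omega>) + \<sigma> * (z s \<omega> - z r \<omega>)"
      by (simp add: algebra_simps)
  qed
qed

lemma x_solution:
  assumes "0 \<le> t"
  shows "AE \<omega> in M. x t \<omega> = exp (- \<alpha> * t) * (x 0 \<omega> + \<sigma> * z t \<omega>) +
    (LINT s:{0..t}|lborel. \<alpha> * exp (- \<alpha> * (t - s)) * (\<sigma> * (z t \<omega> - z s \<omega>)))"
  using x_eq AE_space
proof eventually_elim
  case (elim \<omega>)
  have "x t \<omega> = exp (- \<alpha> * t) * (x 0 \<omega> + \<sigma> * z t \<omega>) +
    (LINT s:{0..t}|lborel. \<alpha> * exp (- \<alpha> * (t - s)) * ((x 0 \<omega> + \<sigma> * z t \<omega>) - (x 0 \<omega> + \<sigma> * z s \<omega>)))"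
  proof (rule linear_integral_equation_solution[of t "\<lambda>t. x t \<omega>" "\<lambda>s. x 0 \<omega> + \<sigma> * z s \<omega>"])
    fix s assume "s \<in> {0..t}"
    then have "x s \<omega> = x 0 \<omega> - \<alpha> * (LINT r:{0..s}|lborel. x r \<omega>) + \<sigma> * z s \<omega>"
      using elim(1) by (meson atLeastAtMost_iff)
    then show "x s \<omega> = x 0 \<omega> + \<sigma> * z s \<omega> - \<alpha> * (LINT r:{0..s}|lborel. x r \<omega>)"
      by linarith
  next
    show "continuous_on {0..t} (\<lambda>s. x s \<omega>)"
      by (rule x_continuous[OF elim(2)]) simp
    show "continuous_on {0..t} (\<lambda>s. x 0 \<omega> + \<sigma> * z s \<omega>)"
      by (intro continuous_on_add continuous_on_const continuous_on_mult z_continuous[OF elim(2)]) simp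
  qed fact
  then show ?case by (simp add: algebra_simps)
qed

lemma increment_power4: "0 \<le> s \<Longrightarrow> s \<le> t \<Longrightarrow> mean_le M (\<lambda>\<omega>. (z t \<omega> - z s \<omega>) ^ 4) (3 * (t - s)\<^sup>2)"
  using increment_moments by (simp add: mean_le_def)

lemma z_power4: "0 \<le> t \<Longrightarrow> mean_le M (\<lambda>\<omega>. z t \<omega> ^ 4) (3 * t\<^sup>2)"
proof (rule mean_le_mono)
  assume "0 \<le> t"
  show "mean_le M (\<lambda>\<omega>. (z t \<omega> - z 0 \<omega>) ^ 4) (3 * t\<^sup>2)"
    using increment_power4[of 0 t] \<open>0 \<le> t\<close> by simp
  have "AE \<omega> in M. z 0 \<omega> = 0"
    using wiener by (simp add: wiener_process_def)
  then show "AE \<omega> in M. 0 \<le> z t \<omega> ^ 4 \<and> z t \<omega> ^ 4 \<le> (z t \<omega> - z 0 \<omega>) ^ 4"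
    by eventually_elim simp
  show "(\<lambda>\<omega>. z t \<omega> ^ 4) \<in> borel_measurable M"
    using z_measurable[OF \<open>0 \<le> t\<close>] by simp
qed

text \<open>The factors 8 come from two uses of \<open>power4_add_le\<close>. The term
  \<open>3 * \<sigma> ^ 4 / \<alpha>\<^sup>2\<close> bounds the damped Wiener value, and
  \<open>6 * \<sigma> ^ 4 / \<alpha>\<^sup>2\<close> the weighted integral of Wiener
  differences.\<close>

definition x_power4_bound :: real where
  "x_power4_bound = 8 * (8 * (expectation (\<lambda>\<omega>. x 0 \<omega> ^ 4) + 3 * \<sigma> ^ 4 / \<alpha>\<^sup>2) + 6 * \<sigma> ^ 4 / \<alpha>\<^sup>2)"

lemma x_power4_bound_nonneg: "0 \<le> x_power4_bound"
  by (simp add: x_power4_bound_def)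

text \<open>Uniformity in \<open>t\<close> holds because each power of time coming from a Wiener
  moment meets an exponentially decaying factor.\<close>

lemma x_power4:
  assumes t: "0 \<le> t"
  shows "mean_le M (\<lambda>\<omega>. x t \<omega> ^ 4) x_power4_bound"
proof -
  define m where "m = expectation (\<lambda>\<omega>. x 0 \<omega> ^ 4)"
  define k where "k s = \<alpha> * exp (- \<alpha> * (t - s))" for s
  define e where "e = exp (- \<alpha> * t)"
  define L where "L \<omega> = (LINT s:{0..t}|lborel. k s * (\<sigma> * (z t \<omega> - z s \<omega>)))" for \<omega>
  have m: "0 \<le> m" by (simp add: m_def)
  have k_cont: "continuous_on {0..t} k"
    unfolding k_def by (intro continuous_intros)
  have k_nonneg: "0 \<le> k s" for s
    using \<alpha>_pos by (simp add: k_def)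
  have z_cont: "\<omega> \<in> space M \<Longrightarrow> continuous_on {0..t} (\<lambda>s. z s \<omega>)" for \<omega>
    by (rule z_continuous) auto
  have [measurable]: "x 0 \<in> borel_measurable M" "z t \<in> borel_measurable M"
    "x t \<in> borel_measurable M"
    using t by (auto intro: x_measurable z_measurable)
  have "mean_le M (\<lambda>\<omega>. LINT s:{0..t}|lborel. k s * (\<sigma> * (z t \<omega> - z s \<omega>)) ^ 4)
      (LINT s:{0..t}|lborel. k s * (\<sigma> ^ 4 * (3 * (t - s)\<^sup>2)))"
  proof (rule mean_le_path_integral)
    fix s assume s: "s \<in> {0..t}"
    show "mean_le M (\<lambda>\<omega>. k s * (\<sigma> * (z t \<omega> - z s \<omega>)) ^ 4) (k s * (\<sigma> ^ 4 * (3 * (t - s)\<^sup>2)))"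
      unfolding power_mult_distrib
      by (intro mean_le_cmult increment_power4) (use s k_nonneg in auto)
  qed (use t k_nonneg in \<open>auto intro!: continuous_intros k_cont z_cont sigma_finite_measure_axioms\<close>)
  moreover have "(LINT s:{0..t}|lborel. k s * (\<sigma> ^ 4 * (3 * (t - s)\<^sup>2))) \<le> 6 * \<sigma> ^ 4 / \<alpha>\<^sup>2"
  proof -
    have "(LINT s:{0..t}|lborel. k s * (\<sigma> ^ 4 * (3 * (t - s)\<^sup>2))) =
        (LINT s:{0..t}|lborel. (3 * \<sigma> ^ 4) * (k s * (t - s)\<^sup>2))"
      by (simp add: mult_ac)
    also have "\<dots> = (3 * \<sigma> ^ 4) * (LINT s:{0..t}|lborel. k s * (t - s)\<^sup>2)"
      by (rule set_integral_mult_right)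
    also have "\<dots> \<le> (3 * \<sigma> ^ 4) * (2 / \<alpha>\<^sup>2)"
      unfolding k_def by (intro mult_left_mono exponential_weight t \<alpha>_pos) auto
    finally show ?thesis by simp
  qed
  ultimately have "mean_le M (\<lambda>\<omega>. LINT s:{0..t}|lborel. k s * (\<sigma> * (z t \<omega> - z s \<omega>)) ^ 4) (6 * \<sigma> ^ 4 / \<alpha>\<^sup>2)"
    by (rule mean_le_trans)
  then have L4: "mean_le M (\<lambda>\<omega>. L \<omega> ^ 4) (6 * \<sigma> ^ 4 / \<alpha>\<^sup>2)"
  proof (rule mean_le_mono)
    have "L \<in> borel_measurable M"
      unfolding L_def
      by (rule borel_measurable_path_integral)
        (use t in \<open>auto intro!: continuous_intros k_cont z_cont z_measurable borel_measurable_times borel_measurable_diff\<close>)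
    then show "(\<lambda>\<omega>. L \<omega> ^ 4) \<in> borel_measurable M" by simp
    show "AE \<omega> in M. 0 \<le> L \<omega> ^ 4 \<and> L \<omega> ^ 4 \<le> (LINT s:{0..t}|lborel. k s * (\<sigma> * (z t \<omega> - z s \<omega>)) ^ 4)"
      using AE_space
    proof eventually_elim
      case (elim \<omega>)
      show ?case
        unfolding L_def
        by (intro conjI path_integral_power4_le continuous_intros k_cont z_cont elim k_nonneg)
          (use exponential_weight[OF t \<alpha>_pos] in \<open>auto simp: k_def\<close>)
    qed
  qed
  \<comment> \<open>The decay \<open>e ^ 4\<close> has to beat the growth
    \<open>3 * t\<^sup>2\<close> of the fourth moment of \<open>z t\<close>; the crude bound of
    \<open>\<alpha> * t\<close> by its exponential suffices.\<close>
  have e: "0 \<le> e ^ 4" "e ^ 4 \<le> 1" "e ^ 4 * t\<^sup>2 \<le> 1 / \<alpha>\<^sup>2"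
  proof -
    have e1: "0 \<le> e" "e \<le> 1" using t \<alpha>_pos by (auto simp: e_def)
    then show "0 \<le> e ^ 4" "e ^ 4 \<le> 1" by (auto intro: power_le_one)
    have "\<alpha> * t \<le> exp (\<alpha> * t)"
      using exp_ge_add_one_self[of "\<alpha> * t"] by linarith
    then have "e * t \<le> 1 / \<alpha>"
      using \<alpha>_pos by (simp add: e_def exp_minus field_simps)
    then have "(e * t)\<^sup>2 \<le> (1 / \<alpha>)\<^sup>2"
      using e1 t by (intro power_mono) auto
    moreover have "e ^ 4 * t\<^sup>2 \<le> e\<^sup>2 * t\<^sup>2"
      using e1 by (intro mult_right_mono power_decreasing) auto
    ultimately show "e ^ 4 * t\<^sup>2 \<le> 1 / \<alpha>\<^sup>2"
      by (simp add: power_mult_distrib power_divide)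
  qed
  have "mean_le M (\<lambda>\<omega>. 8 * (8 * (e ^ 4 * (x 0 \<omega> ^ 4 + \<sigma> ^ 4 * z t \<omega> ^ 4)) + L \<omega> ^ 4))
     (8 * (8 * (e ^ 4 * (m + \<sigma> ^ 4 * (3 * t\<^sup>2))) + 6 * \<sigma> ^ 4 / \<alpha>\<^sup>2))"
    by (intro mean_le_cmult mean_le_add z_power4 t L4) (use x0_power4 in \<open>auto simp: mean_le_def m_def\<close>)
  then have "mean_le M (\<lambda>\<omega>. 8 * (8 * (e ^ 4 * (x 0 \<omega> ^ 4 + \<sigma> ^ 4 * z t \<omega> ^ 4)) + L \<omega> ^ 4)) x_power4_bound"
  proof (rule mean_le_trans)
    have "e ^ 4 * (m + \<sigma> ^ 4 * (3 * t\<^sup>2)) = e ^ 4 * m + 3 * \<sigma> ^ 4 * (e ^ 4 * t\<^sup>2)"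
      by (simp add: algebra_simps)
    also have "\<dots> \<le> 1 * m + 3 * \<sigma> ^ 4 * (1 / \<alpha>\<^sup>2)"
      by (intro add_mono mult_right_mono mult_left_mono e m) auto
    finally show "8 * (8 * (e ^ 4 * (m + \<sigma> ^ 4 * (3 * t\<^sup>2))) + 6 * \<sigma> ^ 4 / \<alpha>\<^sup>2) \<le> x_power4_bound"
      by (simp add: x_power4_bound_def m_def)
  qed
  then show ?thesis
  proof (rule mean_le_mono)
    show "AE \<omega> in M. 0 \<le> x t \<omega> ^ 4 \<and> x t \<omega> ^ 4 \<le>
        8 * (8 * (e ^ 4 * (x 0 \<omega> ^ 4 + \<sigma> ^ 4 * z t \<omega> ^ 4)) + L \<omega> ^ 4)"
      using x_solution[OF t]
    proof eventually_elim
      case (elim \<omega>)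
      then have eq: "x t \<omega> = e * (x 0 \<omega> + \<sigma> * z t \<omega>) + L \<omega>"
        by (simp add: e_def L_def k_def)
      have "x t \<omega> ^ 4 \<le> 8 * ((e * (x 0 \<omega> + \<sigma> * z t \<omega>)) ^ 4 + L \<omega> ^ 4)"
        unfolding eq by (rule power4_add_le)
      also have "(e * (x 0 \<omega> + \<sigma> * z t \<omega>)) ^ 4 \<le> e ^ 4 * (8 * (x 0 \<omega> ^ 4 + (\<sigma> * z t \<omega>) ^ 4))"
        unfolding power_mult_distrib[of e] by (intro mult_left_mono power4_add_le e)
      finally show ?case by (simp add: power_mult_distrib algebra_simps)
    qed
  qed simp
qed

text \<open>Jensen's inequality gives three powers of the length; the fourth comes from integrating
  the uniform moment bound.\<close>

lemma drift_power4:
  assumes "0 \<le> r" "r \<le> s"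
  shows "mean_le M (\<lambda>\<omega>. (LINT u:{r..s}|lborel. x u \<omega>) ^ 4) ((s - r) ^ 4 * x_power4_bound)"
proof -
  have "mean_le M (\<lambda>\<omega>. LINT u:{r..s}|lborel. x u \<omega> ^ 4) (LINT u:{r..s}|lborel. x_power4_bound)"
  proof (rule mean_le_path_integral)
    show "continuous_on {r..s} (\<lambda>u. x u \<omega> ^ 4)" if "\<omega> \<in> space M" for \<omega>
      using that assms by (intro continuous_on_power x_continuous)
    show "mean_le M (\<lambda>\<omega>. x u \<omega> ^ 4) x_power4_bound" if "u \<in> {r..s}" for u
      using that assms by (intro x_power4) simp
  qed (use assms sigma_finite_measure_axioms in simp_all)
  then have "mean_le M (\<lambda>\<omega>. (s - r) ^ 3 * (LINT u:{r..s}|lborel. x u \<omega> ^ 4)) ((s - r) ^ 3 * ((s - r) * x_power4_bound))"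
    using assms by (intro mean_le_cmult) (auto simp: LINT_const)
  then have "mean_le M (\<lambda>\<omega>. (LINT u:{r..s}|lborel. x u \<omega>) ^ 4) ((s - r) ^ 3 * ((s - r) * x_power4_bound))"
  proof (rule mean_le_mono)
    show "AE \<omega> in M. 0 \<le> (LINT u:{r..s}|lborel. x u \<omega>) ^ 4 \<and>
        (LINT u:{r..s}|lborel. x u \<omega>) ^ 4 \<le> (s - r) ^ 3 * (LINT u:{r..s}|lborel. x u \<omega> ^ 4)"
      using AE_space
      by eventually_elim (use assms in \<open>auto intro!: integral_power4_le x_continuous\<close>)
  qed (use assms drift_measurable in simp)
  moreover have "(s - r) ^ 3 * ((s - r) * x_power4_bound) = (s - r) ^ 4 * x_power4_bound"
    by (simp add: power3_eq_cube power4_eq_xxxx mult.assoc)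
  ultimately show ?thesis by simp
qed

text \<open>The Wiener part dictates the order h^2. The drift part is of order h^4 and is brought to
  the same order at the price of \<open>T\<^sup>2\<close>, which is why the step is capped by
  \<open>T\<close>.\<close>

lemma x_increment_power4:
  assumes "0 \<le> r" "r \<le> s" "s - r \<le> h" "h \<le> T"
  shows "mean_le M (\<lambda>\<omega>. (x s \<omega> - x r \<omega>) ^ 4) (8 * (\<alpha> ^ 4 * T\<^sup>2 * x_power4_bound + 3 * \<sigma> ^ 4) * h\<^sup>2)"
proof -
  let ?A = "\<lambda>\<omega>. LINT u:{r..s}|lborel. x u \<omega>"
  have "mean_le M (\<lambda>\<omega>. 8 * (\<alpha> ^ 4 * ?A \<omega> ^ 4 + \<sigma> ^ 4 * (z s \<omega> - z r \<omega>) ^ 4))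
     (8 * (\<alpha> ^ 4 * ((s - r) ^ 4 * x_power4_bound) + \<sigma> ^ 4 * (3 * (s - r)\<^sup>2)))"
    by (intro mean_le_cmult mean_le_add drift_power4 increment_power4) (use assms in auto)
  then have "mean_le M (\<lambda>\<omega>. 8 * (\<alpha> ^ 4 * ?A \<omega> ^ 4 + \<sigma> ^ 4 * (z s \<omega> - z r \<omega>) ^ 4))
     (8 * (\<alpha> ^ 4 * T\<^sup>2 * x_power4_bound + 3 * \<sigma> ^ 4) * h\<^sup>2)"
  proof (rule mean_le_trans)
    have h: "(s - r)\<^sup>2 \<le> h\<^sup>2" "(s - r)\<^sup>2 \<le> T\<^sup>2"
      using assms by (auto intro!: power_mono)
    have "(s - r) ^ 4 = (s - r)\<^sup>2 * (s - r)\<^sup>2" by (simp add: power2_eq_square eval_nat_numeral)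
    also have "\<dots> \<le> T\<^sup>2 * h\<^sup>2" by (intro mult_mono h) auto
    finally have "8 * (\<alpha> ^ 4 * ((s - r) ^ 4 * x_power4_bound) + \<sigma> ^ 4 * (3 * (s - r)\<^sup>2)) \<le>
        8 * (\<alpha> ^ 4 * ((T\<^sup>2 * h\<^sup>2) * x_power4_bound) + \<sigma> ^ 4 * (3 * h\<^sup>2))"
      by (intro mult_left_mono mult_right_mono add_mono x_power4_bound_nonneg h) auto
    then show "8 * (\<alpha> ^ 4 * ((s - r) ^ 4 * x_power4_bound) + \<sigma> ^ 4 * (3 * (s - r)\<^sup>2)) \<le>
        8 * (\<alpha> ^ 4 * T\<^sup>2 * x_power4_bound + 3 * \<sigma> ^ 4) * h\<^sup>2"
      by (simp add: algebra_simps)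
  qed
  then show ?thesis
  proof (rule mean_le_mono)
    show "AE \<omega> in M. 0 \<le> (x s \<omega> - x r \<omega>) ^ 4 \<and>
        (x s \<omega> - x r \<omega>) ^ 4 \<le> 8 * (\<alpha> ^ 4 * ?A \<omega> ^ 4 + \<sigma> ^ 4 * (z s \<omega> - z r \<omega>) ^ 4)"
      using x_increment
    proof eventually_elim
      case (elim \<omega>)
      then have "x s \<omega> - x r \<omega> = - \<alpha> * ?A \<omega> + \<sigma> * (z s \<omega> - z r \<omega>)"
        using assms by blast
      then show ?case
        using power4_add_le[of "- \<alpha> * ?A \<omega>" "\<sigma> * (z s \<omega> - z r \<omega>)"]
        by (simp add: power_mult_distrib)
    qed
    show "(\<lambda>\<omega>. (x s \<omega> - x r \<omega>) ^ 4) \<in> borel_measurable M"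
      using assms x_measurable[of s] x_measurable[of r] by simp
  qed
qed

end

section \<open>Quadratic variation and uniform partitions\<close>

context wiener
begin

text \<open>A termwise estimate would lose a factor \<open>n\<close>. Instead the induction uses
  that the partial sum is known at the left end of the next step, so its product with the next
  centred square has mean 0.\<close>

lemma quadratic_variation:
  assumes h: "0 \<le> h"
  shows "mean_le M (\<lambda>\<omega>. (\<Sum>i<n. (z (real (Suc i) * h) \<omega> - z (real i * h) \<omega>)\<^sup>2 - h)\<^sup>2) (real n * (2 * h\<^sup>2))"
proof -
  define D where "D i \<omega> = z (real (Suc i) * h) \<omega> - z (real i * h) \<omega>" for i \<omega>
  define S where "S n \<omega> = (\<Sum>i<n. (D i \<omega>)\<^sup>2 - h)" for n \<omega>
  have le: "0 \<le> real i * h" "real i * h \<le> real (Suc i) * h" "real (Suc i) * h - real i * h = h" for i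
    using h by (auto intro: mult_right_mono simp: algebra_simps)
  have D: "integrable M (\<lambda>\<omega>. D i \<omega> ^ k)" "expectation (\<lambda>\<omega>. (D i \<omega>)\<^sup>2) = h"
    "expectation (\<lambda>\<omega>. D i \<omega> ^ 4) = 3 * h\<^sup>2" for i k
    unfolding D_def using increment_moments[OF le(1,2)[of i]] by (simp_all only: le(3))
  have S_int: "integrable M (S n)" for n
    unfolding S_def[abs_def] by (auto intro!: Bochner_Integration.integrable_sum Bochner_Integration.integrable_diff D)
  have S_F: "S n \<in> borel_measurable (F (real n * h))" for n
  proof -
    have "D i \<in> borel_measurable (F (real n * h))" if "i < n" for i
      unfolding D_def
      by (rule increment_measurable_F[OF le(1,2)])
        (use that h in \<open>auto intro!: mult_right_mono simp del: of_nat_Suc\<close>)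
    then show ?thesis
      unfolding S_def[abs_def]
      by (intro borel_measurable_sum borel_measurable_diff borel_measurable_power) auto
  qed
  have "mean_le M (\<lambda>\<omega>. (S n \<omega>)\<^sup>2) (real n * (2 * h\<^sup>2))"
  proof (induction n)
    case 0
    then show ?case by (simp add: S_def mean_le_def)
  next
    case (Suc n)
    define Y where "Y \<omega> = (D n \<omega>)\<^sup>2 - h" for \<omega>
    have Y2: "(Y \<omega>)\<^sup>2 = D n \<omega> ^ 4 - 2 * h * (D n \<omega>)\<^sup>2 + h\<^sup>2" for \<omega>
      by (simp add: Y_def power2_diff)
    have "integrable M (\<lambda>\<omega>. (Y \<omega>)\<^sup>2)"
      unfolding Y2 using D(1)[of n 2] D(1)[of n 4] by simp
    \<comment> \<open>The value is \<open>3 * h\<^sup>2 - 2 * h * h + h\<^sup>2\<close>.\<close>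
    moreover have "expectation (\<lambda>\<omega>. (Y \<omega>)\<^sup>2) = 2 * h\<^sup>2"
      unfolding Y2 using D(1)[of n 2] D(1)[of n 4] D(2,3)[of n]
      by (simp add: prob_space) (simp add: power2_eq_square)
    ultimately have mY: "mean_le M (\<lambda>\<omega>. (Y \<omega>)\<^sup>2) (2 * h\<^sup>2)"
      by (simp add: mean_le_def)
    have Y: "integrable M Y" "expectation Y = 0"
      unfolding Y_def[abs_def] using D by (auto simp: prob_space)
    have "integrable M (\<lambda>\<omega>. S n \<omega> * Y \<omega>)" "expectation (\<lambda>\<omega>. S n \<omega> * Y \<omega>) = 0"
      using increment_indep[OF le(1,2)[of n] S_F[of n] S_int[of n], of "\<lambda>x. x\<^sup>2 - h"] Y
      unfolding Y_def[abs_def] D_def by auto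
    then have "mean_le M (\<lambda>\<omega>. 2 * (S n \<omega> * Y \<omega>)) 0"
      by (simp add: mean_le_def)
    from mean_le_add[OF mean_le_add[OF Suc.IH mY] this]
    have "mean_le M (\<lambda>\<omega>. (S n \<omega>)\<^sup>2 + (Y \<omega>)\<^sup>2 + 2 * (S n \<omega> * Y \<omega>)) (real (Suc n) * (2 * h\<^sup>2))"
      by (simp add: algebra_simps)
    moreover have "(S n \<omega>)\<^sup>2 + (Y \<omega>)\<^sup>2 + 2 * (S n \<omega> * Y \<omega>) = (S (Suc n) \<omega>)\<^sup>2" for \<omega>
      by (simp add: S_def Y_def power2_sum)
    ultimately show ?case by simp
  qed
  then show ?thesis by (simp add: S_def D_def)
qed

end

lemma LINT_uniform_partition:
  fixes g :: "real \<Rightarrow> real"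
  assumes "0 \<le> h" "continuous_on {0..} g"
  shows "(\<Sum>i<n. LINT s:{real i * h..real (Suc i) * h}|lborel. g s) = (LINT s:{0..real n * h}|lborel. g s)"
proof (induction n)
  case 0
  then show ?case by (simp add: LINT_singleton)
next
  case (Suc n)
  have "real n * h \<le> real (Suc n) * h" "0 \<le> real n * h"
    using assms by (auto intro: mult_right_mono)
  then show ?case
    using Suc LINT_combine[of 0 "real n * h" "real (Suc n) * h" g] continuous_on_subset[OF assms(2), of "{0..real (Suc n) * h}"]
    by (simp del: of_nat_Suc)
qed

lemma uniform_partition_ex:
  assumes "0 < h" "0 < s" "s \<le> real n * h"
  obtains i where "i < n" "real i * h < s" "s \<le> real (Suc i) * h"
proof -
  define P where "P j \<longleftrightarrow> s \<le> real j * h" for j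
  define m where "m = (LEAST j. P j)"
  have "P n"
    using assms by (simp add: P_def)
  then have "P m" "m \<le> n"
    unfolding m_def by (auto intro: LeastI Least_le)
  moreover have "m \<noteq> 0"
    using \<open>P m\<close> assms by (intro notI) (simp add: P_def)
  then obtain i where "m = Suc i" by (cases m) auto
  moreover have "\<not> P i"
    using not_less_Least[of i P] \<open>m = Suc i\<close> by (simp add: m_def)
  ultimately show thesis
    by (intro that[of i]) (auto simp: P_def)
qed

lemma elementary_value_uniform:
  assumes "0 < h" "i < n" "real i * h < s" "s \<le> real (Suc i) * h"
  shows "elementary_value n (\<lambda>i. real i * h) \<xi> s \<omega> = \<xi> i \<omega>"
proof -
  have "indicator {real j * h<..real (Suc j) * h} s = (if j = i then 1 else 0 :: real)" for j
  proof (cases "j = i")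
    case False
    have "\<not> (real j * h < s \<and> s \<le> real (Suc j) * h)"
    proof
      assume "real j * h < s \<and> s \<le> real (Suc j) * h"
      then have "real j * h < real (Suc i) * h" "real i * h < real (Suc j) * h"
        using assms by linarith+
      then have "j < Suc i" "i < Suc j"
        using \<open>0 < h\<close> by (simp_all only: mult_less_cancel_right_pos of_nat_less_iff)
      then show False using False by simp
    qed
    then show ?thesis using False by (simp add: indicator_def)
  qed (use assms in simp)
  then show ?thesis
    using assms(2) by (simp only: elementary_value_def) (simp only: if_distrib mult_1_right mult_zero_right sum.delta finite_lessThan lessThan_iff if_True cong: if_cong)
qed

lemma ennreal_tendsto_0_if_le_inverse:
  assumes "\<And>k. f k \<le> ennreal (c * (T / real (Suc k)))"
  shows "f \<longlonglongrightarrow> 0"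
proof (rule tendsto_sandwich[of "\<lambda>_. 0"])
  have "(\<lambda>k. c * T * (1 / real (Suc k))) \<longlonglongrightarrow> c * T * 0"
    using LIMSEQ_Suc[OF lim_1_over_n] by (intro tendsto_mult tendsto_const) simp
  then show "(\<lambda>k. ennreal (c * (T / real (Suc k)))) \<longlonglongrightarrow> 0"
    using tendsto_ennrealI by fastforce
qed (use assms in auto)

section \<open>Ito's formula for the squared process\<close>

context ou_process
begin

definition increment_bound :: "real \<Rightarrow> real" where
  "increment_bound T = 8 * (\<alpha> ^ 4 * T\<^sup>2 * x_power4_bound + 3 * \<sigma> ^ 4)"

text \<open>The local error in Ito's formula \<open>\<integral>x \<sigma> dz = (x\<^sup>2 - \<sigma>\<^sup>2 t) / 2 + \<alpha> \<integral>x\<^sup>2 dt\<close>, with the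
  time step replaced by the squared increment of \<open>z\<close>: its mean square is cubic in the step, so
  these errors need no cancellation, unlike those of the quadratic variation.\<close>

definition step_error :: "real \<Rightarrow> real \<Rightarrow> 'a \<Rightarrow> real" where
  "step_error t t' \<omega> = x t \<omega> * (\<sigma> * (z t' \<omega> - z t \<omega>)) - ((x t' \<omega>)\<^sup>2 - (x t \<omega>)\<^sup>2) / 2
     - \<alpha> * (LINT s:{t..t'}|lborel. (x s \<omega>)\<^sup>2) + \<sigma>\<^sup>2 / 2 * (z t' \<omega> - z t \<omega>)\<^sup>2"

text \<open>The factor 3 comes from squaring a sum of three terms. The summands belong in order to
  the squared drift, to drift times Wiener increment, and to freezing \<open>x\<close> at the left
  end. In the first, h^4 is lowered to T * h^3.\<close>

definition step_error_const :: "real \<Rightarrow> real" where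
  "step_error_const T = 3 * (\<alpha> ^ 4 / 4 * (x_power4_bound * T) + \<alpha>\<^sup>2 * \<sigma>\<^sup>2 * ((x_power4_bound + 3) / 2) + \<alpha>\<^sup>2 * ((increment_bound T + x_power4_bound) / 2))"

lemma LINT_x_power2_measurable:
  "0 \<le> t \<Longrightarrow> t \<le> t' \<Longrightarrow> (\<lambda>\<omega>. LINT s:{t..t'}|lborel. (x s \<omega>)\<^sup>2) \<in> borel_measurable M"
  by (intro borel_measurable_path_integral borel_measurable_power x_measurable continuous_on_power x_continuous) auto

lemma step_error_measurable:
  assumes "0 \<le> t" "t \<le> t'"
  shows "step_error t t' \<in> borel_measurable M"
proof -
  have [measurable]: "x t \<in> borel_measurable M" "x t' \<in> borel_measurable M"
    "z t \<in> borel_measurable M" "z t' \<in> borel_measurable M"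
    "(\<lambda>\<omega>. LINT s:{t..t'}|lborel. (x s \<omega>)\<^sup>2) \<in> borel_measurable M"
    using assms by (auto intro!: x_measurable z_measurable LINT_x_power2_measurable)
  show ?thesis
    unfolding step_error_def[abs_def] by measurable
qed

text \<open>After inserting the increment of \<open>x\<close>, all terms of order sqrt h and h
  cancel. What is left is a squared drift integral, drift times Wiener increment, or an integral of
  an increment of \<open>x\<close>, each of mean square at most of order h^3.\<close>

lemma step_error_bound:
  assumes t: "0 \<le> t" "t < t'" "t' - t \<le> T"
  shows "mean_le M (\<lambda>\<omega>. (step_error t t' \<omega>)\<^sup>2) (step_error_const T * (t' - t) ^ 3)"
proof -
  define h where "h = t' - t"
  define A where "A \<omega> = (LINT s:{t..t'}|lborel. x s \<omega>)" for \<omega>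
  define D where "D \<omega> = z t' \<omega> - z t \<omega>" for \<omega>
  \<comment> \<open>The error of replacing the integral of the square of \<open>x\<close> by
    \<open>x t\<close> times the integral of \<open>x\<close>.\<close>
  define R where "R \<omega> = (LINT s:{t..t'}|lborel. (x t \<omega> - x s \<omega>) * x s \<omega>)" for \<omega>
  \<comment> \<open>A majorant for the integral of the squared integrand of \<open>R\<close>,
    written in fourth powers so that the moment bounds apply.\<close>
  define P where "P \<omega> = (LINT s:{t..t'}|lborel. (1 / h * (x s \<omega> - x t \<omega>) ^ 4 + h * x s \<omega> ^ 4) / 2)" for \<omega>
  have h: "0 < h" "h \<le> T" using t by (auto simp: h_def)
  have cont: "continuous_on {t..t'} (\<lambda>s. x s \<omega>)" if "\<omega> \<in> space M" for \<omega>
    by (rule x_continuous[OF that t(1)])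
  have mA: "mean_le M (\<lambda>\<omega>. A \<omega> ^ 4) (h ^ 4 * x_power4_bound)"
    unfolding A_def h_def by (rule drift_power4) (use t in auto)
  have mD: "mean_le M (\<lambda>\<omega>. D \<omega> ^ 4) (3 * h\<^sup>2)"
    unfolding D_def h_def by (rule increment_power4) (use t in auto)
  have mP: "mean_le M P (h * ((1 / h * (increment_bound T * h\<^sup>2) + h * x_power4_bound) / 2))"
  proof -
    have "mean_le M P (LINT s:{t..t'}|lborel. (1 / h * (increment_bound T * h\<^sup>2) + h * x_power4_bound) / 2)"
      unfolding P_def
    proof (rule mean_le_path_integral)
      fix s assume s: "s \<in> {t..t'}"
      have "mean_le M (\<lambda>\<omega>. 1 / 2 * (1 / h * (x s \<omega> - x t \<omega>) ^ 4 + h * x s \<omega> ^ 4))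
          (1 / 2 * (1 / h * (increment_bound T * h\<^sup>2) + h * x_power4_bound))"
        unfolding increment_bound_def
        by (intro mean_le_cmult mean_le_add x_power4 x_increment_power4) (use s t h in \<open>auto simp: h_def\<close>)
      then show "mean_le M (\<lambda>\<omega>. (1 / h * (x s \<omega> - x t \<omega>) ^ 4 + h * x s \<omega> ^ 4) / 2)
          ((1 / h * (increment_bound T * h\<^sup>2) + h * x_power4_bound) / 2)"
        by simp
    next
      show "continuous_on {t..t'} (\<lambda>s. (1 / h * (x s \<omega> - x t \<omega>) ^ 4 + h * x s \<omega> ^ 4) / 2)"
        if "\<omega> \<in> space M" for \<omega>
        using h by (intro continuous_on_divide continuous_on_add continuous_on_mult continuous_on_power
            continuous_on_diff continuous_on_const cont[OF that]) auto
    qed (use t h sigma_finite_measure_axioms in simp_all)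
    then show ?thesis using t by (simp add: LINT_const h_def)
  qed
  have "mean_le M (\<lambda>\<omega>. 3 * (\<alpha> ^ 4 / 4 * A \<omega> ^ 4 + \<alpha>\<^sup>2 * \<sigma>\<^sup>2 * (1 / 2 * (1 / h * A \<omega> ^ 4 + h * D \<omega> ^ 4))
      + \<alpha>\<^sup>2 * (h * P \<omega>)))
    (3 * (\<alpha> ^ 4 / 4 * (h ^ 4 * x_power4_bound) + \<alpha>\<^sup>2 * \<sigma>\<^sup>2 * (1 / 2 * (1 / h * (h ^ 4 * x_power4_bound) + h * (3 * h\<^sup>2)))
      + \<alpha>\<^sup>2 * (h * (h * ((1 / h * (increment_bound T * h\<^sup>2) + h * x_power4_bound) / 2)))))"
    using h by (intro mean_le_cmult mean_le_add mA mD mP) auto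
  then have "mean_le M (\<lambda>\<omega>. 3 * (\<alpha> ^ 4 / 4 * A \<omega> ^ 4 + \<alpha>\<^sup>2 * \<sigma>\<^sup>2 * (1 / 2 * (1 / h * A \<omega> ^ 4 + h * D \<omega> ^ 4))
      + \<alpha>\<^sup>2 * (h * P \<omega>))) (step_error_const T * h ^ 3)"
  proof (rule mean_le_trans)
    have e: "1 / h * (h ^ 4 * x_power4_bound) + h * (3 * h\<^sup>2) = (x_power4_bound + 3) * h ^ 3"
       "h * (h * ((1 / h * (increment_bound T * h\<^sup>2) + h * x_power4_bound) / 2)) = (increment_bound T + x_power4_bound) / 2 * h ^ 3"
      using h by (simp_all add: field_simps eval_nat_numeral)
    have "h ^ 4 * x_power4_bound = h ^ 3 * (h * x_power4_bound)" by (simp add: eval_nat_numeral)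
    also have "\<dots> \<le> h ^ 3 * (T * x_power4_bound)"
      using h by (intro mult_left_mono mult_right_mono x_power4_bound_nonneg) auto
    finally have "\<alpha> ^ 4 / 4 * (h ^ 4 * x_power4_bound) \<le> \<alpha> ^ 4 / 4 * (h ^ 3 * (T * x_power4_bound))"
      by (intro mult_left_mono) auto
    note drift_le = this
    have rhs_eq: "step_error_const T * h ^ 3 = 3 * (\<alpha> ^ 4 / 4 * (h ^ 3 * (T * x_power4_bound)) +
        \<alpha>\<^sup>2 * \<sigma>\<^sup>2 * (1 / 2 * ((x_power4_bound + 3) * h ^ 3)) + \<alpha>\<^sup>2 * ((increment_bound T + x_power4_bound) / 2 * h ^ 3))"
      by (simp add: step_error_const_def field_simps)
    show "3 * (\<alpha> ^ 4 / 4 * (h ^ 4 * x_power4_bound) + \<alpha>\<^sup>2 * \<sigma>\<^sup>2 * (1 / 2 * (1 / h * (h ^ 4 * x_power4_bound) + h * (3 * h\<^sup>2)))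
      + \<alpha>\<^sup>2 * (h * (h * ((1 / h * (increment_bound T * h\<^sup>2) + h * x_power4_bound) / 2)))) \<le> step_error_const T * h ^ 3"
      unfolding e rhs_eq by (intro mult_left_mono add_mono order_refl drift_le) auto
  qed
  then show ?thesis
    unfolding h_def[symmetric]
  proof (rule mean_le_mono)
    show "AE \<omega> in M. 0 \<le> (step_error t t' \<omega>)\<^sup>2 \<and> (step_error t t' \<omega>)\<^sup>2 \<le>
      3 * (\<alpha> ^ 4 / 4 * A \<omega> ^ 4 + \<alpha>\<^sup>2 * \<sigma>\<^sup>2 * (1 / 2 * (1 / h * A \<omega> ^ 4 + h * D \<omega> ^ 4)) + \<alpha>\<^sup>2 * (h * P \<omega>))"
      using x_increment AE_space
    proof eventually_elim
      case (elim \<omega>)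
      note c = cont[OF elim(2)]
      have dx: "x t' \<omega> = x t \<omega> - \<alpha> * A \<omega> + \<sigma> * D \<omega>"
        using elim(1)[rule_format, of t t'] t by (simp add: A_def D_def)
      have i: "set_integrable lborel {t..t'} (\<lambda>s. x t \<omega> * x s \<omega>)"
         "set_integrable lborel {t..t'} (\<lambda>s. (x s \<omega>)\<^sup>2)"
        by (intro borel_integrable_atLeastAtMost' continuous_on_mult continuous_on_const continuous_on_power c)+
      have "R \<omega> = (LINT s:{t..t'}|lborel. x t \<omega> * x s \<omega> - (x s \<omega>)\<^sup>2)"
        by (simp add: R_def power2_eq_square algebra_simps)
      also have "\<dots> = x t \<omega> * A \<omega> - (LINT s:{t..t'}|lborel. (x s \<omega>)\<^sup>2)"
        by (simp only: set_integral_diff(2)[OF i] set_integral_mult_right A_def)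
      finally have R: "(LINT s:{t..t'}|lborel. (x s \<omega>)\<^sup>2) = x t \<omega> * A \<omega> - R \<omega>" by simp
      \<comment> \<open>Here the squared Wiener increments cancel exactly; this is the reason for
        putting them into \<open>step_error\<close> in place of the time step.\<close>
      have "step_error t t' \<omega> = - \<alpha>\<^sup>2 / 2 * (A \<omega>)\<^sup>2 + \<alpha> * \<sigma> * (A \<omega> * D \<omega>) + \<alpha> * R \<omega>"
        unfolding step_error_def R dx D_def[symmetric]
        by (simp add: power2_eq_square field_simps)
      moreover have "(a + b + c)\<^sup>2 \<le> 3 * (a\<^sup>2 + b\<^sup>2 + c\<^sup>2)" for a b c :: real
      proof -
        have "0 \<le> (a - b)\<^sup>2 + (a - c)\<^sup>2 + (b - c)\<^sup>2" by simp
        then show ?thesis by (simp add: power2_eq_square algebra_simps)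
      qed
      ultimately have "(step_error t t' \<omega>)\<^sup>2 \<le>
          3 * ((- \<alpha>\<^sup>2 / 2 * (A \<omega>)\<^sup>2)\<^sup>2 + (\<alpha> * \<sigma> * (A \<omega> * D \<omega>))\<^sup>2 + (\<alpha> * R \<omega>)\<^sup>2)"
        by presburger
      also have "\<dots> = 3 * (\<alpha> ^ 4 / 4 * A \<omega> ^ 4 + \<alpha>\<^sup>2 * \<sigma>\<^sup>2 * (A \<omega> * D \<omega>)\<^sup>2 + \<alpha>\<^sup>2 * (R \<omega>)\<^sup>2)"
        by (simp add: power_mult_distrib power_divide)
      also have "\<dots> \<le> 3 * (\<alpha> ^ 4 / 4 * A \<omega> ^ 4 + \<alpha>\<^sup>2 * \<sigma>\<^sup>2 * (1 / 2 * (1 / h * A \<omega> ^ 4 + h * D \<omega> ^ 4)) + \<alpha>\<^sup>2 * (h * P \<omega>))"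
      proof (intro mult_left_mono add_mono order_refl)
        show "(A \<omega> * D \<omega>)\<^sup>2 \<le> 1 / 2 * (1 / h * A \<omega> ^ 4 + h * D \<omega> ^ 4)"
          using mult_power2_le[OF h(1), of "A \<omega>" "D \<omega>"] by simp
        have "(R \<omega>)\<^sup>2 \<le> (t' - t) * (LINT s:{t..t'}|lborel. ((x t \<omega> - x s \<omega>) * x s \<omega>)\<^sup>2)"
          unfolding R_def using t
          by (intro integral_power2_le continuous_on_mult continuous_on_diff continuous_on_const c) simp
        also have "\<dots> \<le> (t' - t) * P \<omega>"
        proof (intro mult_left_mono)
          show "(LINT s:{t..t'}|lborel. ((x t \<omega> - x s \<omega>) * x s \<omega>)\<^sup>2) \<le> P \<omega>"
            unfolding P_def
          proof (rule set_integral_mono)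
            show "set_integrable lborel {t..t'} (\<lambda>s. ((x t \<omega> - x s \<omega>) * x s \<omega>)\<^sup>2)"
              by (intro borel_integrable_atLeastAtMost' continuous_on_mult continuous_on_diff continuous_on_const continuous_on_power c)
            show "set_integrable lborel {t..t'} (\<lambda>s. (1 / h * (x s \<omega> - x t \<omega>) ^ 4 + h * x s \<omega> ^ 4) / 2)"
              using h by (intro borel_integrable_atLeastAtMost' continuous_on_divide continuous_on_add
                  continuous_on_mult continuous_on_diff continuous_on_const continuous_on_power c) auto
            show "((x t \<omega> - x s \<omega>) * x s \<omega>)\<^sup>2 \<le> (1 / h * (x s \<omega> - x t \<omega>) ^ 4 + h * x s \<omega> ^ 4) / 2" for s
              using mult_power2_le[OF h(1), of "x t \<omega> - x s \<omega>" "x s \<omega>"]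
              by (simp add: power4_eq_xxxx algebra_simps)
          qed
        qed (use t in simp)
        finally show "(R \<omega>)\<^sup>2 \<le> h * P \<omega>" by (simp add: h_def)
      qed auto
      finally show ?case by simp
    qed
    show "(\<lambda>\<omega>. (step_error t t' \<omega>)\<^sup>2) \<in> borel_measurable M"
      using step_error_measurable[of t t'] t by simp
  qed
qed

lemma elementary_process_uniform:
  assumes "0 < T"
  shows "elementary_process M F T (Suc k) (\<lambda>i. real i * (T / real (Suc k)))
    (\<lambda>i \<omega>. a * x (real i * (T / real (Suc k))) \<omega> * \<sigma>)"
proof -
  have "(\<lambda>\<omega>. a * x t \<omega> * \<sigma>) \<in> borel_measurable (F t) \<and> integrable M (\<lambda>\<omega>. (a * x t \<omega> * \<sigma>)\<^sup>2)"
    if "0 \<le> t" for t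
  proof -
    have [measurable]: "x t \<in> borel_measurable (F t)"
      using that by (rule x_measurable_F)
    have "integrable M (\<lambda>\<omega>. (x t \<omega>)\<^sup>2)"
      using integrable_mult_power2[of "\<lambda>\<omega>. (x t \<omega>)\<^sup>2" M "\<lambda>_. 1"] x_power4[OF that] x_measurable[OF that]
      by (simp add: mean_le_def)
    then show ?thesis by (simp add: power_mult_distrib)
  qed
  then show ?thesis
    using assms unfolding elementary_process_def
    by (auto intro!: divide_right_mono mult_right_mono)
qed

text \<open>The case \<open>q = 1\<close> of \<open>mult_power2_le\<close> turns the fourth-moment
  bound of order h^2 into a second-moment bound of order h.\<close>

lemma x_increment_power2:
  assumes "0 \<le> r" "r \<le> s" "s - r \<le> h" "0 < h" "h \<le> T"
  shows "mean_le M (\<lambda>\<omega>. (x s \<omega> - x r \<omega>)\<^sup>2) ((increment_bound T + 1) / 2 * h)"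
proof (rule mean_le_mono)
  have "mean_le M (\<lambda>\<omega>. (x s \<omega> - x r \<omega>) ^ 4) (increment_bound T * h\<^sup>2)"
    unfolding increment_bound_def using assms by (intro x_increment_power4)
  moreover have "mean_le M (\<lambda>_. h) h"
    by (simp add: mean_le_def prob_space)
  ultimately have "mean_le M (\<lambda>\<omega>. 1 / 2 * (1 / h * (x s \<omega> - x r \<omega>) ^ 4 + h)) (1 / 2 * (1 / h * (increment_bound T * h\<^sup>2) + h))"
    using assms by (intro mean_le_cmult mean_le_add) auto
  then show "mean_le M (\<lambda>\<omega>. 1 / 2 * (1 / h * (x s \<omega> - x r \<omega>) ^ 4 + h)) ((increment_bound T + 1) / 2 * h)"
    by (rule mean_le_trans) (use assms in \<open>auto simp: field_simps power2_eq_square\<close>)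
  show "AE \<omega> in M. 0 \<le> (x s \<omega> - x r \<omega>)\<^sup>2 \<and> (x s \<omega> - x r \<omega>)\<^sup>2 \<le> 1 / 2 * (1 / h * (x s \<omega> - x r \<omega>) ^ 4 + h)"
    using mult_power2_le[OF \<open>0 < h\<close>, of "x s \<omega> - x r \<omega>" 1 for \<omega>] by simp
  show "(\<lambda>\<omega>. (x s \<omega> - x r \<omega>)\<^sup>2) \<in> borel_measurable M"
    using assms x_measurable[of s] x_measurable[of r] by simp
qed

text \<open>On each cell the integrand differs from its left-end value by a multiple of an increment
  of \<open>x\<close> over a time of at most \<open>h k\<close>. Tonelli carries the bound at each
  fixed time over to the product space.\<close>

lemma uniform_value_error:
  assumes T: "0 < T"
  defines "h k \<equiv> T / real (Suc k)"
  shows "(\<integral>\<^sup>+\<omega>. (\<integral>\<^sup>+s\<in>{0..T}. ennreal ((a * x s \<omega> * \<sigma> - elementary_value (Suc k)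
      (\<lambda>i. real i * h k) (\<lambda>i \<omega>. a * x (real i * h k) \<omega> * \<sigma>) s \<omega>)\<^sup>2) \<partial>lborel) \<partial>M)
    \<le> ennreal (T * ((a * \<sigma>)\<^sup>2 * ((increment_bound T + 1) / 2)) * h k)"
proof -
  define R where "R = restrict_space lborel {0..T}"
  interpret R: finite_measure R
    unfolding R_def by (rule finite_measure_restrict_space_Icc)
  interpret pair_sigma_finite R M ..
  define V where "V = elementary_value (Suc k) (\<lambda>i. real i * h k) (\<lambda>i \<omega>. a * x (real i * h k) \<omega> * \<sigma>)"
  have h: "0 < h k" "h k \<le> T" "real (Suc k) * h k = T"
    using T by (auto simp: h_def field_simps)
  have increment_bound_nonneg: "0 \<le> increment_bound T" using x_power4_bound_nonneg by (simp add: increment_bound_def)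
  have [measurable]: "(\<lambda>(s, \<omega>). x s \<omega>) \<in> borel_measurable (R \<Otimes>\<^sub>M M)"
    unfolding R_def using T by (intro borel_measurable_continuous_paths x_measurable x_continuous) auto
  have [measurable]: "(\<lambda>(s, \<omega>). V s \<omega>) \<in> borel_measurable (R \<Otimes>\<^sub>M M)"
    unfolding R_def V_def h_def by (rule elementary_value_measurable[OF elementary_process_uniform[OF T]])
  define c where "c = (a * \<sigma>)\<^sup>2 * ((increment_bound T + 1) / 2 * h k)"
  have c_nonneg: "0 \<le> c"
    using h increment_bound_nonneg by (simp add: c_def)
  have le: "(\<integral>\<^sup>+\<omega>. ennreal ((a * x s \<omega> * \<sigma> - V s \<omega>)\<^sup>2) \<partial>M) \<le> ennreal c" if s: "0 < s" "s \<le> T" for s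
  proof -
    obtain i where i: "i < Suc k" "real i * h k < s" "s \<le> real (Suc i) * h k"
      using uniform_partition_ex[OF h(1) s(1), of "Suc k"] s(2) h(3) by auto
    have "mean_le M (\<lambda>\<omega>. (a * \<sigma>)\<^sup>2 * (x s \<omega> - x (real i * h k) \<omega>)\<^sup>2) c"
      unfolding c_def using i h
      by (intro mean_le_cmult x_increment_power2) (auto simp: algebra_simps)
    moreover have "(a * x s \<omega> * \<sigma> - V s \<omega>)\<^sup>2 = (a * \<sigma>)\<^sup>2 * (x s \<omega> - x (real i * h k) \<omega>)\<^sup>2" for \<omega>
      unfolding V_def elementary_value_uniform[OF h(1) i] by (simp add: power2_eq_square algebra_simps)
    ultimately show ?thesis
      using mean_le_nn_integral[of M "\<lambda>\<omega>. (a * x s \<omega> * \<sigma> - V s \<omega>)\<^sup>2" c] by simp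
  qed
  \<comment> \<open>At time 0 no half-open cell applies and the elementary value is 0; a single time
    is negligible.\<close>
  have ae: "AE s in R. 0 < s \<and> s \<le> T"
  proof -
    have "AE s in lborel. s \<noteq> (0::real)" by (rule AE_lborel_singleton)
    then show ?thesis
      unfolding R_def by (subst AE_restrict_space_iff) (auto elim: eventually_mono)
  qed
  have "(\<integral>\<^sup>+\<omega>. (\<integral>\<^sup>+s\<in>{0..T}. ennreal ((a * x s \<omega> * \<sigma> - V s \<omega>)\<^sup>2) \<partial>lborel) \<partial>M) =
      (\<integral>\<^sup>+\<omega>. (\<integral>\<^sup>+s. ennreal ((a * x s \<omega> * \<sigma> - V s \<omega>)\<^sup>2) \<partial>R) \<partial>M)"
    by (simp add: R_def nn_integral_restrict_space)
  also have "\<dots> = (\<integral>\<^sup>+s. (\<integral>\<^sup>+\<omega>. ennreal ((a * x s \<omega> * \<sigma> - V s \<omega>)\<^sup>2) \<partial>M) \<partial>R)"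
    by (rule Fubini') measurable
  also have "\<dots> \<le> (\<integral>\<^sup>+s. ennreal c \<partial>R)"
    by (rule nn_integral_mono_AE) (use ae le in \<open>auto elim: eventually_mono\<close>)
  also have "\<dots> = ennreal (c * T)"
    using T c_nonneg
    by (simp add: R_def emeasure_restrict_space space_restrict_space ennreal_mult)
  finally show ?thesis by (simp add: V_def c_def mult_ac)
qed

text \<open>With N steps, Cauchy-Schwarz for sums bounds the local errors by a multiple of N^2 * h^3
  = T^2 * h, and orthogonality bounds the quadratic variation error by 2 * N * h^2 = 2 * T *
  h.\<close>

lemma uniform_integral_error:
  assumes T: "0 < T"
  defines "h k \<equiv> T / real (Suc k)"
  shows "(\<integral>\<^sup>+\<omega>. ennreal ((a * (((x T \<omega>)\<^sup>2 - (x 0 \<omega>)\<^sup>2 - \<sigma>\<^sup>2 * T) / 2 + \<alpha> * (LINT s:{0..T}|lborel. (x s \<omega>)\<^sup>2))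
      - elementary_integral z (Suc k) (\<lambda>i. real i * h k) (\<lambda>i \<omega>. a * x (real i * h k) \<omega> * \<sigma>) \<omega>)\<^sup>2) \<partial>M)
    \<le> ennreal (2 * a\<^sup>2 * (\<sigma> ^ 4 * T / 2 + step_error_const T * T\<^sup>2) * h k)"
proof -
  define \<tau> where "\<tau> i = real i * h k" for i
  define N where "N = Suc k"
  define E where "E i = step_error (\<tau> i) (\<tau> (Suc i))" for i
  define Q where "Q \<omega> = (\<Sum>i<N. (z (\<tau> (Suc i)) \<omega> - z (\<tau> i) \<omega>)\<^sup>2 - h k)" for \<omega>
  define J where "J = elementary_integral z N \<tau> (\<lambda>i \<omega>. a * x (\<tau> i) \<omega> * \<sigma>)"
  define I where "I \<omega> = a * (((x T \<omega>)\<^sup>2 - (x 0 \<omega>)\<^sup>2 - \<sigma>\<^sup>2 * T) / 2 + \<alpha> * (LINT s:{0..T}|lborel. (x s \<omega>)\<^sup>2))" for \<omega>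
  have h: "0 < h k" "h k \<le> T" "real N * h k = T"
    using T by (auto simp: h_def N_def field_simps)
  have \<tau>: "0 \<le> \<tau> i" "\<tau> i < \<tau> (Suc i)" "\<tau> (Suc i) - \<tau> i = h k" "\<tau> N = T" "\<tau> 0 = 0" for i
    using h by (auto simp: \<tau>_def algebra_simps)
  have E: "mean_le M (\<lambda>\<omega>. (E i \<omega>)\<^sup>2) (step_error_const T * h k ^ 3)" for i
    using step_error_bound[OF \<tau>(1,2), of i T] h by (simp add: E_def \<tau>(3))
  have Q: "mean_le M (\<lambda>\<omega>. (Q \<omega>)\<^sup>2) (real N * (2 * (h k)\<^sup>2))"
    unfolding Q_def \<tau>_def by (rule quadratic_variation) (use h in simp)
  \<comment> \<open>Summed over the cells, the differences of squares telescope and the time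
    integrals join; the squared Wiener increments add up to \<open>T\<close> with error
    \<open>Q\<close>.\<close>
  have eq: "J \<omega> - I \<omega> = a * ((\<Sum>i<N. E i \<omega>) - \<sigma>\<^sup>2 / 2 * Q \<omega>)" if \<omega>: "\<omega> \<in> space M" for \<omega>
  proof -
    have "continuous_on {0..} (\<lambda>s. x s \<omega>)"
      using ou \<omega> by (simp add: ornstein_uhlenbeck_def)
    then have "(\<Sum>i<N. LINT s:{\<tau> i..\<tau> (Suc i)}|lborel. (x s \<omega>)\<^sup>2) = (LINT s:{0..T}|lborel. (x s \<omega>)\<^sup>2)"
      using LINT_uniform_partition[of "h k" "\<lambda>s. (x s \<omega>)\<^sup>2" N] h
      by (simp add: \<tau>_def continuous_on_power del: of_nat_Suc)
    moreover have "(\<Sum>i<N. (x (\<tau> (Suc i)) \<omega>)\<^sup>2 - (x (\<tau> i) \<omega>)\<^sup>2) = (x T \<omega>)\<^sup>2 - (x 0 \<omega>)\<^sup>2"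
      using sum_lessThan_telescope[of "\<lambda>i. (x (\<tau> i) \<omega>)\<^sup>2" N] by (simp add: \<tau>)
    moreover have "Q \<omega> = (\<Sum>i<N. (z (\<tau> (Suc i)) \<omega> - z (\<tau> i) \<omega>)\<^sup>2) - T"
      using h by (simp add: Q_def sum_subtractf)
    moreover have "J \<omega> = a * (\<Sum>i<N. x (\<tau> i) \<omega> * (\<sigma> * (z (\<tau> (Suc i)) \<omega> - z (\<tau> i) \<omega>)))"
      by (simp add: J_def elementary_integral_def sum_distrib_left mult_ac)
    moreover have "(\<Sum>i<N. E i \<omega>) = (\<Sum>i<N. x (\<tau> i) \<omega> * (\<sigma> * (z (\<tau> (Suc i)) \<omega> - z (\<tau> i) \<omega>)))
        - (\<Sum>i<N. (x (\<tau> (Suc i)) \<omega>)\<^sup>2 - (x (\<tau> i) \<omega>)\<^sup>2) / 2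
        - \<alpha> * (\<Sum>i<N. LINT s:{\<tau> i..\<tau> (Suc i)}|lborel. (x s \<omega>)\<^sup>2)
        + \<sigma>\<^sup>2 / 2 * (\<Sum>i<N. (z (\<tau> (Suc i)) \<omega> - z (\<tau> i) \<omega>)\<^sup>2)"
      unfolding E_def step_error_def sum_distrib_left sum_divide_distrib
        sum_subtractf[symmetric] sum.distrib[symmetric] ..
    ultimately have "(\<Sum>i<N. E i \<omega>) - \<sigma>\<^sup>2 / 2 * Q \<omega> =
        (\<Sum>i<N. x (\<tau> i) \<omega> * (\<sigma> * (z (\<tau> (Suc i)) \<omega> - z (\<tau> i) \<omega>))) - ((x T \<omega>)\<^sup>2 - (x 0 \<omega>)\<^sup>2) / 2
        - \<alpha> * (LINT s:{0..T}|lborel. (x s \<omega>)\<^sup>2) + \<sigma>\<^sup>2 / 2 * T"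
      and "J \<omega> = a * (\<Sum>i<N. x (\<tau> i) \<omega> * (\<sigma> * (z (\<tau> (Suc i)) \<omega> - z (\<tau> i) \<omega>)))"
      by (simp_all only: right_diff_distrib)
    then show ?thesis
      by (simp only: I_def) (simp add: field_simps)
  qed
  have "mean_le M (\<lambda>\<omega>. a\<^sup>2 * (2 * (real N * (\<Sum>i<N. (E i \<omega>)\<^sup>2) + \<sigma> ^ 4 / 4 * (Q \<omega>)\<^sup>2)))
      (a\<^sup>2 * (2 * (real N * (\<Sum>i<N. step_error_const T * h k ^ 3) + \<sigma> ^ 4 / 4 * (real N * (2 * (h k)\<^sup>2)))))"
    by (intro mean_le_cmult mean_le_add mean_le_sum E Q) auto
  moreover have "a\<^sup>2 * (2 * (real N * (\<Sum>i<N. step_error_const T * h k ^ 3) + \<sigma> ^ 4 / 4 * (real N * (2 * (h k)\<^sup>2)))) =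
      2 * a\<^sup>2 * (\<sigma> ^ 4 * T / 2 + step_error_const T * T\<^sup>2) * h k"
    unfolding h(3)[symmetric] by (simp add: power2_eq_square power3_eq_cube algebra_simps)
  ultimately have "mean_le M (\<lambda>\<omega>. a\<^sup>2 * (2 * (real N * (\<Sum>i<N. (E i \<omega>)\<^sup>2) + \<sigma> ^ 4 / 4 * (Q \<omega>)\<^sup>2)))
      (2 * a\<^sup>2 * (\<sigma> ^ 4 * T / 2 + step_error_const T * T\<^sup>2) * h k)"
    by metis
  then have "(\<integral>\<^sup>+\<omega>. ennreal (a\<^sup>2 * (2 * (real N * (\<Sum>i<N. (E i \<omega>)\<^sup>2) + \<sigma> ^ 4 / 4 * (Q \<omega>)\<^sup>2))) \<partial>M) \<le>
      ennreal (2 * a\<^sup>2 * (\<sigma> ^ 4 * T / 2 + step_error_const T * T\<^sup>2) * h k)"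
    by (rule mean_le_nn_integral) (simp add: sum_nonneg)
  moreover have "(\<integral>\<^sup>+\<omega>. ennreal ((I \<omega> - J \<omega>)\<^sup>2) \<partial>M) \<le>
      (\<integral>\<^sup>+\<omega>. ennreal (a\<^sup>2 * (2 * (real N * (\<Sum>i<N. (E i \<omega>)\<^sup>2) + \<sigma> ^ 4 / 4 * (Q \<omega>)\<^sup>2))) \<partial>M)"
  proof (intro nn_integral_mono ennreal_leI)
    fix \<omega> assume \<omega>: "\<omega> \<in> space M"
    have "(I \<omega> - J \<omega>)\<^sup>2 = a\<^sup>2 * ((\<Sum>i<N. E i \<omega>) - \<sigma>\<^sup>2 / 2 * Q \<omega>)\<^sup>2"
      using eq[OF \<omega>] by (metis power2_commute power_mult_distrib)
    also have "\<dots> \<le> a\<^sup>2 * (2 * ((\<Sum>i<N. E i \<omega>)\<^sup>2 + (\<sigma>\<^sup>2 / 2 * Q \<omega>)\<^sup>2))"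
    proof (rule mult_left_mono)
      show "(p - q)\<^sup>2 \<le> 2 * (p\<^sup>2 + q\<^sup>2)" for p q :: real
        using zero_le_power2[of "p + q"] by (simp add: power2_eq_square algebra_simps)
    qed simp
    also have "(\<sigma>\<^sup>2 / 2 * Q \<omega>)\<^sup>2 = \<sigma> ^ 4 / 4 * (Q \<omega>)\<^sup>2"
      by (simp add: power_mult_distrib power_divide)
    also have "(\<Sum>i<N. E i \<omega>)\<^sup>2 \<le> real N * (\<Sum>i<N. (E i \<omega>)\<^sup>2)"
      using sum_squared_le_sum_of_squares[of "\<lambda>i. E i \<omega>" "{..<N}"] by (simp add: mult.commute)
    finally show "(I \<omega> - J \<omega>)\<^sup>2 \<le> a\<^sup>2 * (2 * (real N * (\<Sum>i<N. (E i \<omega>)\<^sup>2) + \<sigma> ^ 4 / 4 * (Q \<omega>)\<^sup>2))"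
      by (simp add: mult_left_mono)
  qed
  ultimately show ?thesis
    unfolding I_def J_def N_def \<tau>_def by (rule order_trans[rotated])
qed

text \<open>The candidate is Ito's formula d(x^2) = 2 x dx + \<sigma>^2 dt with dx inserted and
  solved for the integral of x \<sigma> dz.\<close>

lemma has_ito_integral_linear:
  assumes T: "0 < T"
  shows "has_ito_integral M F z T (\<lambda>s \<omega>. a * x s \<omega> * \<sigma>)
    (\<lambda>\<omega>. a * (((x T \<omega>)\<^sup>2 - (x 0 \<omega>)\<^sup>2 - \<sigma>\<^sup>2 * T) / 2 + \<alpha> * (LINT s:{0..T}|lborel. (x s \<omega>)\<^sup>2)))"
  unfolding has_ito_integral_def
proof (intro conjI ballI exI allI)
  have [measurable]: "(\<lambda>(s, \<omega>). x s \<omega>) \<in> borel_measurable (restrict_space lborel {0..T} \<Otimes>\<^sub>M M)"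
    using T by (intro borel_measurable_continuous_paths x_measurable x_continuous) auto
  show "(\<lambda>(s, \<omega>). a * x s \<omega> * \<sigma>) \<in> borel_measurable (restrict_space lborel {0..T} \<Otimes>\<^sub>M M)"
    by measurable
  have [measurable]: "x T \<in> borel_measurable M" "x 0 \<in> borel_measurable M"
    "(\<lambda>\<omega>. LINT s:{0..T}|lborel. (x s \<omega>)\<^sup>2) \<in> borel_measurable M"
    using T by (auto intro!: x_measurable LINT_x_power2_measurable)
  show "(\<lambda>\<omega>. a * (((x T \<omega>)\<^sup>2 - (x 0 \<omega>)\<^sup>2 - \<sigma>\<^sup>2 * T) / 2 + \<alpha> * (LINT s:{0..T}|lborel. (x s \<omega>)\<^sup>2)))
      \<in> borel_measurable M"
    by measurable
  show "(\<lambda>\<omega>. a * x s \<omega> * \<sigma>) \<in> borel_measurable (F s)" if "s \<in> {0..T}" for s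
    using x_measurable_F[of s] that by simp
  show "elementary_process M F T (Suc k) (\<lambda>i. real i * (T / real (Suc k)))
    (\<lambda>i \<omega>. a * x (real i * (T / real (Suc k))) \<omega> * \<sigma>)" for k
    by (rule elementary_process_uniform[OF T])
qed (rule ennreal_tendsto_0_if_le_inverse, rule uniform_value_error[OF T] uniform_integral_error[OF T])+

section \<open>Wealth and utility of linear policies\<close>

text \<open>The time integral in the closed form of the Ito integral cancels the drift of wealth.
  Measurability is recorded separately because the chosen integral agrees with the closed form only
  almost surely, and exchanging them under an expectation requires it.\<close>

lemma log_wealth_linear:
  assumes t: "0 < t"
  shows "log_wealth M F z \<alpha> \<sigma> x u\<^sub>0 (\<lambda>y. a * y) t \<in> borel_measurable M"
    and "AE \<omega> in M. log_wealth M F z \<alpha> \<sigma> x u\<^sub>0 (\<lambda>y. a * y) t \<omega> =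
      u\<^sub>0 - a * \<sigma>\<^sup>2 * t / 2 + a / 2 * ((x t \<omega>)\<^sup>2 - (x 0 \<omega>)\<^sup>2)"
proof -
  define I where "I = ito_integral M F z t (\<lambda>s \<omega>. a * x s \<omega> * \<sigma>)"
  have I: "has_ito_integral M F z t (\<lambda>s \<omega>. a * x s \<omega> * \<sigma>) I"
    unfolding I_def ito_integral_def by (rule someI[of "has_ito_integral M F z t (\<lambda>s \<omega>. a * x s \<omega> * \<sigma>)"])
      (rule has_ito_integral_linear[OF t])
  have lw: "log_wealth M F z \<alpha> \<sigma> x u\<^sub>0 (\<lambda>y. a * y) t \<omega> =
      u\<^sub>0 + (- a * \<alpha>) * (LINT s:{0..t}|lborel. (x s \<omega>)\<^sup>2) + I \<omega>" for \<omega>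
  proof -
    have "(LINT s:{0..t}|lborel. a * x s \<omega> * (- \<alpha> * x s \<omega>)) = (LINT s:{0..t}|lborel. (- a * \<alpha>) * (x s \<omega>)\<^sup>2)"
      by (simp add: power2_eq_square mult_ac)
    also have "\<dots> = (- a * \<alpha>) * (LINT s:{0..t}|lborel. (x s \<omega>)\<^sup>2)"
      by (rule set_integral_mult_right)
    finally show ?thesis
      by (simp add: log_wealth_def I_def)
  qed
  have [measurable]: "I \<in> borel_measurable M" "(\<lambda>\<omega>. LINT s:{0..t}|lborel. (x s \<omega>)\<^sup>2) \<in> borel_measurable M"
    using I t by (auto simp: has_ito_integral_def intro!: LINT_x_power2_measurable)
  show "log_wealth M F z \<alpha> \<sigma> x u\<^sub>0 (\<lambda>y. a * y) t \<in> borel_measurable M"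
    unfolding lw[abs_def] by measurable
  show "AE \<omega> in M. log_wealth M F z \<alpha> \<sigma> x u\<^sub>0 (\<lambda>y. a * y) t \<omega> =
      u\<^sub>0 - a * \<sigma>\<^sup>2 * t / 2 + a / 2 * ((x t \<omega>)\<^sup>2 - (x 0 \<omega>)\<^sup>2)"
    using has_ito_integral_unique[OF I has_ito_integral_linear[OF t]]
    by eventually_elim (simp only: lw, simp add: field_simps)
qed

text \<open>Apart from a deterministic part linear in \<open>t\<close>, wealth consists of boundary
  terms at times 0 and \<open>t\<close>, whose second moments are bounded by
  \<open>x_power4\<close>. Hence neither bound grows with \<open>t\<close>.\<close>

lemma log_wealth_moments:
  fixes a u\<^sub>0 :: real
  assumes t: "0 < t"
  defines "u \<equiv> log_wealth M F z \<alpha> \<sigma> x u\<^sub>0 (\<lambda>y. a * y) t"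
  shows "\<bar>expectation u + a * \<sigma>\<^sup>2 * t / 2\<bar> \<le> \<bar>u\<^sub>0\<bar> + \<bar>a\<bar> / 2 * (1 + 4 * x_power4_bound)"
    and "\<bar>variance u\<bar> \<le> a\<^sup>2 * x_power4_bound"
proof -
  define W where "W \<omega> = (x t \<omega>)\<^sup>2 - (x 0 \<omega>)\<^sup>2" for \<omega>
  have [measurable]: "x t \<in> borel_measurable M" "x 0 \<in> borel_measurable M"
    using t by (auto intro: x_measurable)
  have W [measurable]: "W \<in> borel_measurable M"
    unfolding W_def[abs_def] by measurable
  have "mean_le M (\<lambda>\<omega>. 2 * (x t \<omega> ^ 4 + x 0 \<omega> ^ 4)) (2 * (x_power4_bound + x_power4_bound))"
    using t by (intro mean_le_cmult mean_le_add x_power4) auto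
  then have W2: "mean_le M (\<lambda>\<omega>. (W \<omega>)\<^sup>2) (2 * (x_power4_bound + x_power4_bound))"
  proof (rule mean_le_mono)
    have "(p\<^sup>2 - q\<^sup>2)\<^sup>2 \<le> 2 * (p ^ 4 + q ^ 4)" for p q :: real
      using zero_le_power2[of "p\<^sup>2 + q\<^sup>2"] by (simp add: power2_eq_square power4_eq_xxxx algebra_simps)
    then show "AE \<omega> in M. 0 \<le> (W \<omega>)\<^sup>2 \<and> (W \<omega>)\<^sup>2 \<le> 2 * (x t \<omega> ^ 4 + x 0 \<omega> ^ 4)"
      by (simp add: W_def)
  qed simp
  have Wi: "integrable M W" "integrable M (\<lambda>\<omega>. (W \<omega>)\<^sup>2)"
    using integrable_mult_power2[of W M "\<lambda>_. 1"] W2 by (auto simp: mean_le_def)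
  have EW: "\<bar>expectation W\<bar> \<le> 1 + 4 * x_power4_bound"
  proof -
    \<comment> \<open>Only the second moment of \<open>W\<close> is bounded so far; this passes to
      the first without square roots.\<close>
    have "\<bar>w\<bar> \<le> 1 + w\<^sup>2" for w :: real
      using zero_le_power2[of "\<bar>w\<bar> - 1"] by (simp add: power2_eq_square algebra_simps)
    then have "expectation (\<lambda>\<omega>. \<bar>W \<omega>\<bar>) \<le> expectation (\<lambda>\<omega>. 1 + (W \<omega>)\<^sup>2)"
      using Wi by (intro integral_mono) auto
    also have "\<dots> \<le> 1 + 4 * x_power4_bound"
      using W2 by (simp add: mean_le_def prob_space)
    finally show ?thesis
      using integral_abs_bound[of M W] by linarith
  qed
  have u_meas [measurable]: "u \<in> borel_measurable M"
    unfolding u_def by (rule log_wealth_linear(1)[OF t])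
  define c where "c = u\<^sub>0 - a * \<sigma>\<^sup>2 * t / 2"
  have u: "AE \<omega> in M. u \<omega> = c + a / 2 * W \<omega>"
    unfolding u_def c_def W_def by (rule log_wealth_linear(2)[OF t])
  have Eu: "expectation u = c + a / 2 * expectation W"
  proof -
    have "expectation u = expectation (\<lambda>\<omega>. c + a / 2 * W \<omega>)"
      by (rule integral_cong_AE) (use u in auto)
    then show ?thesis using Wi by (simp add: prob_space)
  qed
  have "\<bar>u\<^sub>0 + a / 2 * expectation W\<bar> \<le> \<bar>u\<^sub>0\<bar> + \<bar>a\<bar> / 2 * \<bar>expectation W\<bar>"
    using abs_triangle_ineq[of u\<^sub>0 "a / 2 * expectation W"] by (simp add: abs_mult)
  also have "\<dots> \<le> \<bar>u\<^sub>0\<bar> + \<bar>a\<bar> / 2 * (1 + 4 * x_power4_bound)"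
    by (intro add_left_mono mult_left_mono EW) auto
  finally show "\<bar>expectation u + a * \<sigma>\<^sup>2 * t / 2\<bar> \<le> \<bar>u\<^sub>0\<bar> + \<bar>a\<bar> / 2 * (1 + 4 * x_power4_bound)"
    by (simp add: Eu c_def)
  have "variance u = expectation (\<lambda>\<omega>. (a / 2)\<^sup>2 * (W \<omega> - expectation W)\<^sup>2)"
  proof (rule integral_cong_AE)
    show "AE \<omega> in M. (u \<omega> - expectation u)\<^sup>2 = (a / 2)\<^sup>2 * (W \<omega> - expectation W)\<^sup>2"
      using u by eventually_elim (simp add: Eu power_mult_distrib[symmetric] right_diff_distrib)
  qed auto
  also have "\<dots> = (a / 2)\<^sup>2 * variance W"
    by simp
  also have "\<dots> \<le> (a / 2)\<^sup>2 * (4 * x_power4_bound)"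
  proof (rule mult_left_mono)
    show "variance W \<le> 4 * x_power4_bound"
    proof -
      have "variance W \<le> expectation (\<lambda>\<omega>. (W \<omega>)\<^sup>2)"
        unfolding variance_eq[OF Wi] by simp
      also have "\<dots> \<le> 4 * x_power4_bound"
        using W2 by (simp add: mean_le_def)
      finally show ?thesis .
    qed
  qed simp
  finally show "\<bar>variance u\<bar> \<le> a\<^sup>2 * x_power4_bound"
    by (simp add: power_divide)
qed

text \<open>The errors in mean and variance are collected in a constant \<open>B\<close>, so the
  quotient differs from its limit by at most \<open>B / t\<close>. The lower limit is thus a genuine
  limit.\<close>

lemma investor_utility_linear:
  "investor_utility M \<gamma> (log_wealth M F z \<alpha> \<sigma> x u\<^sub>0 (\<lambda>y. a * y)) = ereal (- a * \<sigma>\<^sup>2 / 2)"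
proof -
  define u where "u = log_wealth M F z \<alpha> \<sigma> x u\<^sub>0 (\<lambda>y. a * y)"
  define U where "U t = 1 / t * (expectation (u t) - \<gamma> * variance (u t))" for t
  define B where "B = \<bar>u\<^sub>0\<bar> + \<bar>a\<bar> / 2 * (1 + 4 * x_power4_bound) + \<bar>\<gamma>\<bar> * (a\<^sup>2 * x_power4_bound)"
  have bound: "norm (U t - (- a * \<sigma>\<^sup>2 / 2)) \<le> B / t" if t: "0 < t" for t
  proof -
    note m = log_wealth_moments[OF t, of u\<^sub>0 a, folded u_def]
    have "\<bar>\<gamma> * variance (u t)\<bar> \<le> \<bar>\<gamma>\<bar> * (a\<^sup>2 * x_power4_bound)"
      unfolding abs_mult by (intro mult_left_mono m) auto
    then have "\<bar>expectation (u t) + a * \<sigma>\<^sup>2 * t / 2 - \<gamma> * variance (u t)\<bar> \<le> B"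
      using m(1) unfolding B_def by linarith
    moreover have "U t - (- a * \<sigma>\<^sup>2 / 2) =
        (expectation (u t) + a * \<sigma>\<^sup>2 * t / 2 - \<gamma> * variance (u t)) / t"
      using t by (simp add: U_def field_simps)
    ultimately show ?thesis
      using t by (simp add: divide_right_mono)
  qed
  have "((\<lambda>t. B / t) \<longlongrightarrow> 0) at_top"
    by (rule real_tendsto_divide_at_top[OF tendsto_const filterlim_ident])
  then have "((\<lambda>t. U t - (- a * \<sigma>\<^sup>2 / 2)) \<longlongrightarrow> 0) at_top"
    by (rule Lim_null_comparison[rotated]) (rule eventually_mono[OF eventually_gt_at_top[of 0] bound])
  then have "((\<lambda>t. ereal (U t)) \<longlongrightarrow> ereal (- a * \<sigma>\<^sup>2 / 2)) at_top"
    by (intro tendsto_ereal) (simp only: LIM_zero_iff)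
  then show ?thesis
    unfolding investor_utility_def u_def[symmetric] U_def by (rule lim_imp_Liminf[rotated]) simp
qed

end

text \<open>Reduces the maximization to one real parameter, the slope. The derivative is constant,
  so its bound at the single point 0 already bounds the slope.\<close>

lemma linear_D_policies_eq: "linear_D_policies K = (\<lambda>a y. a * y) ` {-K..K}"
proof (intro equalityI subsetI)
  fix f assume f: "f \<in> linear_D_policies K"
  then have "linear f" by (simp add: linear_D_policies_def)
  define a where "a = f 1"
  have eq: "f = (\<lambda>y. a * y)"
  proof
    show "f y = a * y" for y
      using linear_scale[OF \<open>linear f\<close>, of y 1] by (simp add: a_def)
  qed
  have "\<bar>deriv f 0\<bar> \<le> K"
    using f by (simp add: linear_D_policies_def D_policies_def)
  then have "\<bar>a\<bar> \<le> K"
    by (simp add: eq)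
  then show "f \<in> (\<lambda>a y. a * y) ` {-K..K}"
    using eq by (intro image_eqI[of _ _ a]) (auto simp: abs_le_iff)
next
  fix f assume "f \<in> (\<lambda>a y. a * y) ` {-K..K}"
  then obtain a where a: "\<bar>a\<bar> \<le> K" "f = (\<lambda>y. a * y)" by force
  have "(f has_vector_derivative a) (at y)" for y
    unfolding a(2) by (auto intro!: derivative_eq_intros)
  then have "f C1_differentiable_on UNIV"
    unfolding C1_differentiable_on_def by (intro exI[of _ "\<lambda>_. a"]) auto
  moreover have "linear f"
    unfolding a(2) by (rule linear_times)
  ultimately show "f \<in> linear_D_policies K"
    using a by (simp add: linear_D_policies_def D_policies_def)
qed

theorem theorem3p3:
  fixes M :: "'a measure" and F :: "real \<Rightarrow> 'a measure"
    and z x :: "real \<Rightarrow> 'a \<Rightarrow> real"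
    and \<alpha> \<sigma> \<gamma> K u\<^sub>0 :: real and f :: "real \<Rightarrow> real"
  assumes "filtered_prob_space M F"
    and "wiener_process M F z"
    and "\<alpha> > 0" and "\<sigma> > 0"
    and "ornstein_uhlenbeck M F z \<alpha> \<sigma> x"
    and "integrable M (\<lambda>\<omega>. (x 0 \<omega>) ^ 4)"
    and "K \<ge> 0"
  shows "optimal_policy (\<lambda>g. investor_utility M \<gamma> (log_wealth M F z \<alpha> \<sigma> x u\<^sub>0 g))
           (linear_D_policies K) f
         \<longleftrightarrow> f = (\<lambda>x. - K * x)"
proof -
  interpret prob_space M
    using assms(1) by (simp add: filtered_prob_space_def)
  interpret ou_process M F z x \<alpha> \<sigma>
    by unfold_locales (use assms in auto)
  \<comment> \<open>Positivity of \<open>\<sigma>\<close> makes utility strictly decreasing in the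
    slope; having an equivalence is what gives uniqueness of the maximizer as well as
    existence.\<close>
  have utility_le: "investor_utility M \<gamma> (log_wealth M F z \<alpha> \<sigma> x u\<^sub>0 (\<lambda>y. a * y)) \<le>
      investor_utility M \<gamma> (log_wealth M F z \<alpha> \<sigma> x u\<^sub>0 (\<lambda>y. b * y)) \<longleftrightarrow> b \<le> a" for a b
    unfolding investor_utility_linear using \<open>\<sigma> > 0\<close> by simp
  show ?thesis
    unfolding optimal_policy_def linear_D_policies_eq
  proof (intro iffI conjI ballI)
    assume opt: "f \<in> (\<lambda>a y. a * y) ` {-K..K} \<and>
      (\<forall>g\<in>(\<lambda>a y. a * y) ` {-K..K}. investor_utility M \<gamma> (log_wealth M F z \<alpha> \<sigma> x u\<^sub>0 g) \<le>
        investor_utility M \<gamma> (log_wealth M F z \<alpha> \<sigma> x u\<^sub>0 f))"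
    then obtain b where b: "b \<in> {-K..K}" "f = (\<lambda>y. b * y)" by blast
    \<comment> \<open>\<open>K \<ge> 0\<close> makes the extreme slope \<open>- K\<close>
      admissible, so the optimal slope \<open>b\<close> can be compared with it.\<close>
    have "(\<lambda>y. - K * y) \<in> (\<lambda>a y. a * y) ` {-K..K}"
      using \<open>K \<ge> 0\<close> by (intro image_eqI[of _ _ "- K"]) auto
    then have "b \<le> - K"
      using opt unfolding b(2) utility_le[symmetric] by blast
    then show "f = (\<lambda>x. - K * x)"
      using b by auto
  next
    assume f: "f = (\<lambda>x. - K * x)"
    show "f \<in> (\<lambda>a y. a * y) ` {-K..K}"
      using f \<open>K \<ge> 0\<close> by (intro image_eqI[of _ _ "- K"]) auto
    fix g assume "g \<in> (\<lambda>a y. a * y) ` {-K..K}"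
    then obtain a where "a \<in> {-K..K}" "g = (\<lambda>y. a * y)" by blast
    then show "investor_utility M \<gamma> (log_wealth M F z \<alpha> \<sigma> x u\<^sub>0 g) \<le>
        investor_utility M \<gamma> (log_wealth M F z \<alpha> \<sigma> x u\<^sub>0 f)"
      using utility_le[of a "- K"] f by simp
  qed
qed

end
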